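(* Let $r\ge 2$ be an integer, let $\Omega\subset\mathbb{R}^p$ be a bounded domain with $0\in\Omega$, and let $X_0,X_1,\dots,X_n$ be real vector fields on $\Omega$ such that the coefficients of $X_1,\dots,X_n$ belong to $C^{r-1}(\Omega)$ and the coefficients of $X_0$ belong to $C^{r-2}(\Omega)$. Assume that they satisfy Hörmander's condition of step $r$ at $x=0$, i.e. the vectors $\{(X_{[I]})_0\}_{|I|\le r}$ span $\mathbb{R}^p$. Then there exist an integer $m\ge 0$ and vector fields $\widetilde X_0,\dots,\widetilde X_n$ in $\mathbb{R}^{p+m}$ (defined on $\Omega\times\mathbb{R}^m$, with variables $(x,t_1,\dots,t_m)$), of the form $$\widetilde X_k = X_k+\sum_{j=1}^m u_{kj}(x,t_1,t_2,\dots,t_{j-1})\frac{\partial}{\partial t_j}\qquad (k=0,1,\dots,n),$$ where the $u_{kj}$ are polynomials, such that the $\widetilde X_k$'s are free of weight $r$ at $0$ and the vectors $\{(\widetilde X_{[I]})_0\}_{|I|\le r}$ span $\mathbb{R}^{p+m}$.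
   Context: Weights: $X_0$ has weight $p_0=2$ and $X_i$ has weight $p_i=1$ for $i=1,\dots,n$. For a (nonempty) multiindex $I=(i_1,\dots,i_k)$ with $i_j\in\{0,\dots,n\}$, its weight is $|I|=\sum_{j=1}^k p_{i_j}$. Set $X_{[I]}=[X_{i_1},[X_{i_2},\dots[X_{i_{k-1}},X_{i_k}]\dots]]$ (iterated Lie bracket; $X_{[(i)]}=X_i$); $(X_{[I]})_x$ denotes the vector field $X_{[I]}$ evaluated at $x$. Under the stated regularity, $X_{[I]}$ is well defined for $|I|\le r$. The same notation is used for $\widetilde X_0,\dots,\widetilde X_n$. Universal constants $A_{IJ}$: in noncommuting indeterminates $\xi_0,\dots,\xi_n$, put $\xi_J=\xi_{j_1}\cdots\xi_{j_l}$ and $\xi_{[I]}=[\xi_{i_1},[\dots,[\xi_{i_{k-1}},\xi_{i_k}]\dots]]$ with $[a,b]=ab-ba$; then $\xi_{[I]}=\sum_J A_{IJ}\xi_J$. Free: vector fields $X_0,\dots,X_n$ are free (up to) weight $s\le r$ at a point $x$ if for every family of real constants $\{a_I\}_{|I|\le s}$, $\sum_{|I|\le s}a_I(X_{[I]})_x=0$ implies $\sum_{|I|\le s}a_IA_{IJ}=0$ for all $J$. *)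

theory Defs
  imports "HOL-Analysis.Analysis" "HOL-Library.Poly_Mapping"
begin

text \<open>
  Dimensions are values here (the conclusion asserts the existence of some dimension \<open>p + m\<close>), so
  \<open>\<real>\<^sup>N\<close> is the library's \<open>Euclidean_space N\<close>: the functions \<open>nat \<Rightarrow> real\<close> that vanish at all
  indices \<open>\<ge> N\<close>. Coordinates are numbered from \<open>0\<close>. The topology on \<open>nat \<Rightarrow> real\<close> used by
  \<open>continuous_on\<close> is the product topology, which induces the topology of \<open>Euclidean_space N\<close>.
\<close>

type_synonym point = "nat \<Rightarrow> real"

text \<open>
  A vector field is given by its coefficient functions: \<open>Y i x\<close> is the coefficient of
  \<open>\<partial>/\<partial>x\<^sub>i\<close> at \<open>x\<close>. In dimension \<open>N\<close> only the coefficients with \<open>i < N\<close> are meaningful.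
\<close>

type_synonym vfield = "nat \<Rightarrow> point \<Rightarrow> real"

definition partial_deriv :: "nat \<Rightarrow> (point \<Rightarrow> real) \<Rightarrow> point \<Rightarrow> real" where
  "partial_deriv i f x = deriv (\<lambda>s. f (x(i := s))) (x i)"

text \<open>\<open>C\<^sup>k(U)\<close> for an open subset \<open>U\<close> of \<open>\<real>\<^sup>N\<close>.\<close>

primrec Ck :: "nat \<Rightarrow> point set \<Rightarrow> nat \<Rightarrow> (point \<Rightarrow> real) \<Rightarrow> bool" where
  "Ck N U 0 f \<longleftrightarrow> continuous_on U f"
| "Ck N U (Suc k) f \<longleftrightarrow>
     continuous_on U f \<and>
     (\<forall>i<N. (\<forall>x\<in>U. (\<lambda>s. f (x(i := s))) differentiable at (x i)) \<and>
            Ck N U k (partial_deriv i f))"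

definition bounded_domain :: "nat \<Rightarrow> point set \<Rightarrow> bool" where
  "bounded_domain N U \<longleftrightarrow>
     openin (Euclidean_space N) U \<and> connectedin (Euclidean_space N) U \<and> U \<noteq> {} \<and>
     (\<exists>B. \<forall>x\<in>U. L2_set x {..<N} \<le> B)"

text \<open>\<open>[Y, Z] = YZ - ZY\<close> as first order differential operators on \<open>\<real>\<^sup>N\<close>.\<close>

definition lie_bracket :: "nat \<Rightarrow> vfield \<Rightarrow> vfield \<Rightarrow> vfield" where
  "lie_bracket N Y Z =
     (\<lambda>i x. \<Sum>j<N. Y j x * partial_deriv j (Z i) x - Z j x * partial_deriv j (Y i) x)"

definition multiindex :: "nat \<Rightarrow> nat list \<Rightarrow> bool" where
  "multiindex n I \<longleftrightarrow> I \<noteq> [] \<and> set I \<subseteq> {0..n}"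

definition weight :: "nat list \<Rightarrow> nat" where
  "weight I = (\<Sum>i\<leftarrow>I. if i = 0 then 2 else 1)"

definition multiindices_upto :: "nat \<Rightarrow> nat \<Rightarrow> nat list set" where
  "multiindices_upto n s = {I. multiindex n I \<and> weight I \<le> s}"

lemma finite_multiindices_upto: "finite (multiindices_upto n s)"
proof (rule finite_subset)
  have "length I \<le> weight I" for I
    by (induction I) (auto simp: weight_def)
  then show "multiindices_upto n s \<subseteq> {I. set I \<subseteq> {0..n} \<and> length I \<le> s}"
    unfolding multiindices_upto_def multiindex_def using le_trans by blast
  show "finite {I. set I \<subseteq> {0..n} \<and> length I \<le> s}"
    by (rule finite_lists_length_le) simp
qed

text \<open>The fields \<open>X\<^bsub>[I]\<^esub>\<close>; the value at the empty list is irrelevant.\<close>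

fun iter_bracket :: "nat \<Rightarrow> (nat \<Rightarrow> vfield) \<Rightarrow> nat list \<Rightarrow> vfield" where
  "iter_bracket N X [] = (\<lambda>i x. 0)"
| "iter_bracket N X [i] = X i"
| "iter_bracket N X (i # j # I) = lie_bracket N (X i) (iter_bracket N X (j # I))"

definition spans_at :: "nat \<Rightarrow> nat \<Rightarrow> nat \<Rightarrow> (nat \<Rightarrow> vfield) \<Rightarrow> point \<Rightarrow> bool" where
  "spans_at N n r X x \<longleftrightarrow>
     (\<forall>v. \<exists>c :: nat list \<Rightarrow> real. \<forall>i<N.
        v i = (\<Sum>I\<in>multiindices_upto n r. c I * iter_bracket N X I i x))"

text \<open>
  Noncommutative polynomials are finitely supported real functions on words under concatenation;
  with lists as a monoid, the product on \<open>nat list \<Rightarrow>\<^sub>0 real\<close> is the one of the free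
  associative algebra.
\<close>

instantiation list :: (type) monoid_add
begin

definition zero_list :: "'a list" where "zero_list = []"

definition plus_list :: "'a list \<Rightarrow> 'a list \<Rightarrow> 'a list" where "plus_list xs ys = xs @ ys"

instance
  by standard (simp_all add: zero_list_def plus_list_def)

end

type_synonym nc_poly = "nat list \<Rightarrow>\<^sub>0 real"

definition xi :: "nat \<Rightarrow> nc_poly" where
  "xi i = Poly_Mapping.single [i] 1"

definition commutator :: "nc_poly \<Rightarrow> nc_poly \<Rightarrow> nc_poly" where
  "commutator a b = a * b - b * a"

fun xi_bracket :: "nat list \<Rightarrow> nc_poly" where
  "xi_bracket [] = 0"
| "xi_bracket [i] = xi i"
| "xi_bracket (i # j # I) = commutator (xi i) (xi_bracket (j # I))"

text \<open>\<open>A\<^bsub>IJ\<^esub>\<close>: the coefficient of the word \<open>\<xi>\<^sub>J\<close> in \<open>\<xi>\<^bsub>[I]\<^esub>\<close>.\<close>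

definition A_coeff :: "nat list \<Rightarrow> nat list \<Rightarrow> real" where
  "A_coeff I J = Poly_Mapping.lookup (xi_bracket I) J"

definition free_at :: "nat \<Rightarrow> nat \<Rightarrow> nat \<Rightarrow> (nat \<Rightarrow> vfield) \<Rightarrow> point \<Rightarrow> bool" where
  "free_at N n s X x \<longleftrightarrow>
     (\<forall>a :: nat list \<Rightarrow> real.
        (\<forall>i<N. (\<Sum>I\<in>multiindices_upto n s. a I * iter_bracket N X I i x) = 0) \<longrightarrow>
        (\<forall>J. multiindex n J \<longrightarrow> (\<Sum>I\<in>multiindices_upto n s. a I * A_coeff I J) = 0))"

text \<open>Real polynomials in the coordinates \<open>z\<^sub>0, \<dots>, z\<^bsub>q-1\<^esub>\<close> only.\<close>

definition polynomial_in_first :: "nat \<Rightarrow> (point \<Rightarrow> real) \<Rightarrow> bool" where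
  "polynomial_in_first q f \<longleftrightarrow>
     (\<exists>(E :: (nat \<Rightarrow> nat) set) (c :: (nat \<Rightarrow> nat) \<Rightarrow> real). finite E \<and>
        (\<forall>z. f z = (\<Sum>\<alpha>\<in>E. c \<alpha> * (\<Prod>i<q. z i ^ \<alpha> i))))"

text \<open>
  A point \<open>(x, t)\<close> of \<open>\<real>\<^bsup>p+m\<^esup>\<close> has \<open>x\<close> at the indices \<open>0, \<dots>, p - 1\<close> and \<open>t\<^sub>1, \<dots>, t\<^sub>m\<close> at the
  indices \<open>p, \<dots>, p + m - 1\<close>. For \<open>Y\<close> on \<open>U \<subseteq> \<real>\<^sup>p\<close>, \<open>lift_field p Y u\<close> is the field
  \<open>Y + \<Sum>\<^sub>j u\<^sub>j \<partial>/\<partial>t\<^bsub>j+1\<^esub>\<close> (\<open>0 \<le> j < m\<close>) on \<open>U \<times> \<real>\<^sup>m\<close>.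
\<close>

definition x_part :: "nat \<Rightarrow> point \<Rightarrow> point" where
  "x_part p z = (\<lambda>i. if i < p then z i else 0)"

definition lift_field :: "nat \<Rightarrow> vfield \<Rightarrow> (nat \<Rightarrow> point \<Rightarrow> real) \<Rightarrow> vfield" where
  "lift_field p Y u = (\<lambda>i z. if i < p then Y i (x_part p z) else u (i - p) z)"

end

theory Submission
  imports Defs
begin

text \<open>
  Following Hoermander and Melin, one variable \<open>t\<close> is added at a time. Let \<open>s \<le> r\<close> be the least
  weight at which the fields \<open>X\<^sub>k\<close> fail to be free at \<open>0\<close>: there are \<open>a\<^sub>I\<close> with
  \<open>\<Sum> a\<^sub>I (X\<^bsub>[I]\<^esub>)\<^sub>0 = 0\<close>, while the element \<open>P = \<Sum> a\<^sub>I \<xi>\<^bsub>[I]\<^esub> = \<Sum>\<^sub>k P\<^sub>k \<xi>\<^sub>k\<close> of the free associative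
  algebra is not zero. For \<open>X'\<^sub>k = X\<^sub>k + u\<^sub>k(x) \<partial>/\<partial>t\<close> the vector \<open>\<Sum> a\<^sub>I (X'\<^bsub>[I]\<^esub>)\<^sub>0\<close> has \<open>x\<close>-part \<open>0\<close> and
  \<open>t\<close>-part \<open>\<Sum>\<^sub>k P\<^sub>k(X) u\<^sub>k (0)\<close>. If this can be made nonzero, the new fields span at \<open>0\<close> again; as
  the dimension of the span is bounded by the number of multiindices, the process stops, and it
  stops only at a free system.

  So let \<open>Q = P\<^sub>k \<noteq> 0\<close>, of weight \<open>\<le> s - 1\<close>; a monomial \<open>u\<close> with \<open>Q(X)u(0) \<noteq> 0\<close> is needed. By the
  Leibniz rule the kernel of \<open>Q \<mapsto> (u \<mapsto> Q(X)u(0))\<close> is a coideal for the coproduct that makes the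
  \<open>\<xi>\<^sub>i\<close> primitive, so a nonzero element of minimal length in it is primitive. By the
  Dynkin--Specht--Wever formula it is a combination of the \<open>\<xi>\<^bsub>[I]\<^esub>\<close>, and applied to the coordinate
  functions it contradicts freeness at weight \<open>s - 1\<close>.
\<close>


section \<open>Functions of class \<open>C\<^sup>k\<close>\<close>

text \<open>The second difference \<open>\<Delta>\<close> over a square of side \<open>h\<close>
  equals \<open>h * h\<close> times a value of \<open>g12\<close> and also \<open>h * h\<close>
  times a value of \<open>g21\<close>, by the mean value theorem in the two orders. If the mixed
  derivatives differed at the corner, continuity would keep these two values apart.\<close>

lemma mixed_derivatives_commute:
  fixes g g1 g2 g12 g21 :: "real \<Rightarrow> real \<Rightarrow> real"
  assumes e: "e > 0"
    and g1: "\<And>s t. \<bar>s - a\<bar> < e \<Longrightarrow> \<bar>t - b\<bar> < e \<Longrightarrow> ((\<lambda>s. g s t) has_real_derivative g1 s t) (at s)"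
    and g2: "\<And>s t. \<bar>s - a\<bar> < e \<Longrightarrow> \<bar>t - b\<bar> < e \<Longrightarrow> ((\<lambda>t. g s t) has_real_derivative g2 s t) (at t)"
    and g12: "\<And>s t. \<bar>s - a\<bar> < e \<Longrightarrow> \<bar>t - b\<bar> < e \<Longrightarrow> ((\<lambda>t. g1 s t) has_real_derivative g12 s t) (at t)"
    and g21: "\<And>s t. \<bar>s - a\<bar> < e \<Longrightarrow> \<bar>t - b\<bar> < e \<Longrightarrow> ((\<lambda>s. g2 s t) has_real_derivative g21 s t) (at s)"
    and c12: "isCont (\<lambda>(s, t). g12 s t) (a, b)"
    and c21: "isCont (\<lambda>(s, t). g21 s t) (a, b)"
  shows "g12 a b = g21 a b"
proof (rule ccontr)
  assume neq: "g12 a b \<noteq> g21 a b"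
  define d where "d = \<bar>g12 a b - g21 a b\<bar> / 2"
  have d: "d > 0" using neq by (simp add: d_def)
  obtain d1 where d1: "d1 > 0" "\<And>y. dist y (a, b) < d1 \<Longrightarrow> dist (case_prod g12 y) (g12 a b) < d"
    using c12 d unfolding continuous_at_eps_delta by (metis case_prod_conv)
  obtain d2 where d2: "d2 > 0" "\<And>y. dist y (a, b) < d2 \<Longrightarrow> dist (case_prod g21 y) (g21 a b) < d"
    using c21 d unfolding continuous_at_eps_delta by (metis case_prod_conv)
  \<comment> \<open>Inner points of the square lie within \<open>2 * h\<close> of the corner, so
    dividing by 3 keeps them inside both continuity neighbourhoods.\<close>
  define h where "h = min e (min d1 d2) / 3"
  have h: "h > 0" "h < e" "2 * h < d1" "2 * h < d2"
    using e d1(1) d2(1) by (auto simp: h_def min_def)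
  have in_box: "\<bar>s - a\<bar> < e" if "a \<le> s" "s \<le> a + h" for s a
    using that h by auto
  define \<Delta> where "\<Delta> = g (a + h) (b + h) - g (a + h) b - g a (b + h) + g a b"
  have near: "dist (s, t) (a, b) < 2 * h" if "a < s" "s < a + h" "b < t" "t < b + h" for s t
  proof -
    have "dist (s, t) (a, b) \<le> \<bar>s - a\<bar> + \<bar>t - b\<bar>"
      using sqrt_sum_squares_le_sum_abs[of "s - a" "t - b"] by (simp add: dist_Pair_Pair dist_real_def)
    then show ?thesis using that by auto
  qed
  have "\<exists>s>a. s < a + h \<and> (g (a + h) (b + h) - g (a + h) b) - (g a (b + h) - g a b)
      = (a + h - a) * (g1 s (b + h) - g1 s b)"
    by (rule MVT2[of a "a + h" "\<lambda>s. g s (b + h) - g s b"])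
      (use h in \<open>auto intro!: DERIV_diff g1 in_box\<close>)
  then obtain s where s: "a < s" "s < a + h" "\<Delta> = h * (g1 s (b + h) - g1 s b)"
    by (auto simp: \<Delta>_def algebra_simps)
  have "\<exists>t>b. t < b + h \<and> g1 s (b + h) - g1 s b = (b + h - b) * g12 s t"
    by (rule MVT2) (use h s in \<open>auto intro!: g12 in_box\<close>)
  then obtain t where t: "b < t" "t < b + h" "\<Delta> = h * (h * g12 s t)"
    using s(3) by auto
  have "\<exists>t>b. t < b + h \<and> (g (a + h) (b + h) - g a (b + h)) - (g (a + h) b - g a b)
      = (b + h - b) * (g2 (a + h) t - g2 a t)"
    by (rule MVT2[of b "b + h" "\<lambda>t. g (a + h) t - g a t"])
      (use h in \<open>auto intro!: DERIV_diff g2 in_box\<close>)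
  then obtain t' where t': "b < t'" "t' < b + h" "\<Delta> = h * (g2 (a + h) t' - g2 a t')"
    by (auto simp: \<Delta>_def algebra_simps)
  have "\<exists>s>a. s < a + h \<and> g2 (a + h) t' - g2 a t' = (a + h - a) * g21 s t'"
    by (rule MVT2) (use h t' in \<open>auto intro!: g21 in_box\<close>)
  then obtain s' where s': "a < s'" "s' < a + h" "\<Delta> = h * (h * g21 s' t')"
    using t'(3) by auto
  have eq: "g12 s t = g21 s' t'"
    using t(3) s'(3) h(1) by simp
  have "dist (g12 s t) (g12 a b) < d"
    using d1(2)[of "(s, t)"] near[OF s(1,2) t(1,2)] h by simp
  moreover have "dist (g21 s' t') (g21 a b) < d"
    using d2(2)[of "(s', t')"] near[OF s'(1,2) t'(1,2)] h by simp
  ultimately show False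
    unfolding d_def eq dist_real_def by argo
qed

lemma continuous_on_fun_upd: "continuous_on UNIV (\<lambda>s. (x::point)(i := s))"
proof (rule continuous_on_coordinatewise_then_product)
  show "continuous_on UNIV (\<lambda>s. (x(i := s)) j)" for j
    by (cases "j = i") auto
qed

lemma continuous_on_fun_upd2: "continuous_on UNIV (\<lambda>(s, t). (x::point)(i := s, j := t))"
proof (rule continuous_on_coordinatewise_then_product)
  show "continuous_on UNIV (\<lambda>st. (case st of (s, t) \<Rightarrow> x(i := s, j := t)) k)" for k
    by (cases "k = j"; cases "k = i") (auto simp: case_prod_unfold intro!: continuous_intros)
qed

lemma eventually_fun_upd:
  assumes "open V" "x \<in> V"
  shows "\<forall>\<^sub>F s in nhds (x i). (x::point)(i := s) \<in> V"
proof -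
  have "open ((\<lambda>s. x(i := s)) -` V)"
    using open_vimage[OF assms(1)] continuous_on_fun_upd by blast
  moreover have "x i \<in> (\<lambda>s. x(i := s)) -` V"
    using assms(2) by simp
  ultimately show ?thesis
    unfolding eventually_nhds by blast
qed

lemma Ck_continuous: "Ck N V k f \<Longrightarrow> continuous_on V f"
  by (cases k) auto

lemma Ck_Suc_imp: "Ck N V (Suc k) f \<Longrightarrow> Ck N V k f"
  by (induction k arbitrary: f) auto

lemma Ck_mono: "Ck N V k f \<Longrightarrow> l \<le> k \<Longrightarrow> Ck N V l f"
proof (induction k)
  case (Suc k)
  then show ?case using Ck_Suc_imp le_Suc_eq by blast
qed simp

lemma Ck_partial_deriv: "Ck N V k f \<Longrightarrow> l < k \<Longrightarrow> i < N \<Longrightarrow> Ck N V l (partial_deriv i f)"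
  by (cases k) (auto intro: Ck_mono)

lemma Ck_has_derivative:
  assumes "Ck N V k f" "0 < k" "i < N" "x \<in> V"
  shows "((\<lambda>s. f (x(i := s))) has_real_derivative partial_deriv i f x) (at (x i))"
  using assms unfolding partial_deriv_def
  by (cases k) (auto simp: DERIV_deriv_iff_real_differentiable)

lemma partial_deriv_eqI:
  "((\<lambda>s. f (x(i := s))) has_real_derivative D) (at (x i)) \<Longrightarrow> partial_deriv i f x = D"
  unfolding partial_deriv_def by (rule DERIV_imp_deriv)

lemma eventually_eq_fun_upd:
  assumes "open V" "x \<in> V" "\<And>y. y \<in> V \<Longrightarrow> f y = g y"
  shows "\<forall>\<^sub>F s in nhds (x i). f ((x::point)(i := s)) = g (x(i := s))"
  using eventually_fun_upd[OF assms(1,2)] by eventually_elim (rule assms(3))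

lemma partial_deriv_cong:
  assumes "open V" "x \<in> V" "\<And>y. y \<in> V \<Longrightarrow> f y = g y"
  shows "partial_deriv i f x = partial_deriv i g x"
  unfolding partial_deriv_def by (rule deriv_cong_ev[OF eventually_eq_fun_upd[OF assms] refl])

text \<open>Functions are total here, but only their values on \<open>V\<close> matter: as
  \<open>V\<close> is open, derivatives at points of \<open>V\<close> see nothing else.\<close>

lemma Ck_cong:
  assumes "open V" "\<And>y. y \<in> V \<Longrightarrow> f y = g y" "Ck N V k f"
  shows "Ck N V k g"
  using assms(2,3)
proof (induction k arbitrary: f g)
  case 0
  then show ?case using continuous_on_cong by (metis Ck.simps(1))
next
  case (Suc k)
  have "Ck N V k (partial_deriv i g)" if "i < N" for i
    by (rule Suc.IH[of "partial_deriv i f"])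
      (use Suc.prems that in \<open>auto intro: partial_deriv_cong[OF assms(1)]\<close>)
  moreover have "(\<lambda>s. g (x(i := s))) differentiable at (x i)" if "i < N" "x \<in> V" for i x
  proof -
    have "(\<lambda>s. f (x(i := s))) differentiable at (x i)"
      using Suc.prems that by simp
    moreover have "\<forall>\<^sub>F s in nhds (x i). f (x(i := s)) = g (x(i := s))"
      by (rule eventually_eq_fun_upd[OF assms(1) that(2)]) (rule Suc.prems)
    ultimately show ?thesis
      unfolding real_differentiable_def by (simp only: DERIV_cong_ev[OF refl _ refl])
  qed
  moreover have "continuous_on V g"
    using Suc.prems by (metis Ck.simps(2) continuous_on_cong)
  ultimately show ?case by simp
qed

lemma Ck_SucI:
  assumes "open V" "continuous_on V f"
    and "\<And>i x. i < N \<Longrightarrow> x \<in> V \<Longrightarrow> ((\<lambda>s. f (x(i := s))) has_real_derivative f' i x) (at (x i))"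
    and "\<And>i. i < N \<Longrightarrow> Ck N V k (f' i)"
  shows "Ck N V (Suc k) f"
proof -
  have "Ck N V k (partial_deriv i f)" if "i < N" for i
    by (rule Ck_cong[OF assms(1) _ assms(4)[OF that]])
      (rule partial_deriv_eqI[OF assms(3)[OF that], symmetric])
  then show ?thesis
    using assms(2,3) by (auto simp: real_differentiable_def)
qed

lemma Ck_const: "open V \<Longrightarrow> Ck N V k (\<lambda>_. c)"
proof (induction k arbitrary: c)
  case (Suc k)
  show ?case by (rule Ck_SucI[where f' = "\<lambda>_ _. 0"]) (use Suc in auto)
qed simp

lemma Ck_add:
  assumes "open V" "Ck N V k f" "Ck N V k g"
  shows "Ck N V k (\<lambda>x. f x + g x)"
  using assms(2,3)
proof (induction k arbitrary: f g)
  case (Suc k)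
  have "((\<lambda>s. f (x(i := s)) + g (x(i := s))) has_real_derivative
      partial_deriv i f x + partial_deriv i g x) (at (x i))" if "i < N" "x \<in> V" for i x
    by (intro DERIV_add Ck_has_derivative[OF Suc.prems(1) _ that] Ck_has_derivative[OF Suc.prems(2) _ that])
      auto
  moreover have "Ck N V k (\<lambda>x. partial_deriv i f x + partial_deriv i g x)" if "i < N" for i
    using Suc that by auto
  moreover have "continuous_on V f" "continuous_on V g"
    using Suc.prems by auto
  ultimately show ?case
    by (intro Ck_SucI[OF assms(1) continuous_on_add])
qed (auto intro: continuous_intros)

lemma Ck_mult:
  assumes "open V" "Ck N V k f" "Ck N V k g"
  shows "Ck N V k (\<lambda>x. f x * g x)"
  using assms(2,3)
proof (induction k arbitrary: f g)
  case (Suc k)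
  have "((\<lambda>s. f (x(i := s)) * g (x(i := s))) has_real_derivative
      partial_deriv i f x * g x + partial_deriv i g x * f x) (at (x i))" if "i < N" "x \<in> V" for i x
    using DERIV_mult[OF Ck_has_derivative[OF Suc.prems(1) _ that] Ck_has_derivative[OF Suc.prems(2) _ that]]
    by (simp only: fun_upd_triv zero_less_Suc)
  moreover have "Ck N V k (\<lambda>x. partial_deriv i f x * g x + partial_deriv i g x * f x)" if "i < N" for i
    using Suc that by (intro Ck_add[OF assms(1)] Suc.IH) (auto intro: Ck_Suc_imp)
  moreover have "continuous_on V f" "continuous_on V g"
    using Suc.prems by auto
  ultimately show ?case
    by (intro Ck_SucI[OF assms(1) continuous_on_mult])
qed (auto intro: continuous_intros)

lemma Ck_diff:
  assumes "open V" "Ck N V k f" "Ck N V k g"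
  shows "Ck N V k (\<lambda>x. f x - g x)"
  using Ck_add[OF assms(1,2) Ck_mult[OF assms(1) Ck_const[OF assms(1), of N k "-1"] assms(3)]]
  by simp

lemma Ck_sum:
  assumes "open V" "\<And>j. j \<in> A \<Longrightarrow> Ck N V k (f j)"
  shows "Ck N V k (\<lambda>x. \<Sum>j\<in>A. f j x)"
  using assms(2)
  by (induction A rule: infinite_finite_induct) (auto intro!: Ck_const Ck_add assms(1))

lemma continuous_on_coordinate: "continuous_on V (\<lambda>x::point. x i)"
  by (rule continuous_on_subset[OF continuous_on_product_coordinates]) simp

lemma partial_deriv_coordinate: "partial_deriv j (\<lambda>x. x i) x = (if i = j then 1 else 0)"
  by (rule partial_deriv_eqI, cases "i = j") auto

lemma Ck_coordinate:
  assumes "open V"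
  shows "Ck N V k (\<lambda>x. x i)"
proof (cases k)
  case 0
  then show ?thesis by (simp add: continuous_on_coordinate)
next
  case (Suc l)
  have "((\<lambda>s. (x(j := s)) i) has_real_derivative (if i = j then 1 else 0)) (at (x j))"
    for x :: point and j
    by (cases "i = j") auto
  then show ?thesis
    unfolding Suc
    by (intro Ck_SucI[where f' = "\<lambda>j _. if i = j then 1 else 0"] assms Ck_const
        continuous_on_coordinate)
qed

text \<open>The map \<open>P\<close> isolates the two coordinates concerned; openness of
  \<open>V\<close> yields a square on which the two-variable statement applies.\<close>

lemma partial_deriv_commute:
  assumes V: "open V" and x: "x \<in> V" and f: "Ck N V 2 f" and ij: "i < N" "j < N"
  shows "partial_deriv j (partial_deriv i f) x = partial_deriv i (partial_deriv j f) x"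
proof (cases "i = j")
  case False
  define P where "P = (\<lambda>(s, t). x(i := s, j := t))"
  have cP: "continuous_on UNIV P"
    unfolding P_def by (rule continuous_on_fun_upd2)
  have oW: "open (P -` V)"
    using open_vimage[OF V cP] .
  have "(x i, x j) \<in> P -` V"
    using x by (simp add: P_def)
  then obtain A B where AB: "open A" "open B" "(x i, x j) \<in> A \<times> B" "A \<times> B \<subseteq> P -` V"
    using open_prod_elim[OF oW] by metis
  then obtain e1 e2 where e1: "e1 > 0" "ball (x i) e1 \<subseteq> A" and e2: "e2 > 0" "ball (x j) e2 \<subseteq> B"
    by (meson SigmaE2 open_contains_ball)
  have inV: "x(i := s, j := t) \<in> V" if "\<bar>s - x i\<bar> < min e1 e2" "\<bar>t - x j\<bar> < min e1 e2" for s t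
  proof -
    have "s \<in> A" "t \<in> B"
      using that e1 e2 by (auto simp: subset_eq dist_real_def abs_minus_commute)
    then show ?thesis using AB(4) by (auto simp: P_def)
  qed
  have D1: "((\<lambda>s. h (x(i := s, j := t))) has_real_derivative partial_deriv i h (x(i := s, j := t))) (at s)"
    if "Ck N V 1 h" "\<bar>s - x i\<bar> < min e1 e2" "\<bar>t - x j\<bar> < min e1 e2" for h s t
    using Ck_has_derivative[OF that(1) _ ij(1) inV[OF that(2,3)]] False
    by (simp add: fun_upd_twist)
  have D2: "((\<lambda>t. h (x(i := s, j := t))) has_real_derivative partial_deriv j h (x(i := s, j := t))) (at t)"
    if "Ck N V 1 h" "\<bar>s - x i\<bar> < min e1 e2" "\<bar>t - x j\<bar> < min e1 e2" for h s t
    using Ck_has_derivative[OF that(1) _ ij(2) inV[OF that(2,3)]] by simp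
  have cont: "isCont (\<lambda>(s, t). h (x(i := s, j := t))) (x i, x j)" if "continuous_on V h" for h
  proof -
    have "continuous_on (P -` V) (h \<circ> P)"
      by (rule continuous_on_compose[OF continuous_on_subset[OF cP] continuous_on_subset[OF that]]) auto
    then have "isCont (h \<circ> P) (x i, x j)"
      using oW \<open>(x i, x j) \<in> P -` V\<close> continuous_on_eq_continuous_at by blast
    then show ?thesis by (simp add: P_def comp_def case_prod_unfold)
  qed
  have reg: "Ck N V 1 f" "Ck N V 1 (partial_deriv i f)" "Ck N V 1 (partial_deriv j f)"
    "continuous_on V (partial_deriv j (partial_deriv i f))"
    "continuous_on V (partial_deriv i (partial_deriv j f))"
    using Ck_mono[OF f] f ij by (auto simp: numeral_2_eq_2)
  have "partial_deriv j (partial_deriv i f) (x(i := x i, j := x j)) =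
    partial_deriv i (partial_deriv j f) (x(i := x i, j := x j))"
    using e1(1) e2(1)
    by (intro mixed_derivatives_commute[where e = "min e1 e2" and
          g = "\<lambda>s t. f (x(i := s, j := t))" and
          ?g1.0 = "\<lambda>s t. partial_deriv i f (x(i := s, j := t))" and
          ?g2.0 = "\<lambda>s t. partial_deriv j f (x(i := s, j := t))"]
        D1[OF reg(1)] D2[OF reg(1)] D2[OF reg(2)] D1[OF reg(3)] cont[OF reg(4)] cont[OF reg(5)]) simp
  then show ?thesis by simp
qed simp

section \<open>Rules for partial derivatives\<close>

lemma partial_deriv_const: "partial_deriv i (\<lambda>_. c) x = 0"
  by (rule partial_deriv_eqI) simp

lemma partial_deriv_add:
  assumes "Ck N V 1 f" "Ck N V 1 g" "i < N" "x \<in> V"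
  shows "partial_deriv i (\<lambda>x. f x + g x) x = partial_deriv i f x + partial_deriv i g x"
  by (intro partial_deriv_eqI DERIV_add Ck_has_derivative[OF assms(1) _ assms(3,4)]
      Ck_has_derivative[OF assms(2) _ assms(3,4)]) simp_all

lemma partial_deriv_diff:
  assumes "Ck N V 1 f" "Ck N V 1 g" "i < N" "x \<in> V"
  shows "partial_deriv i (\<lambda>x. f x - g x) x = partial_deriv i f x - partial_deriv i g x"
  by (intro partial_deriv_eqI DERIV_diff Ck_has_derivative[OF assms(1) _ assms(3,4)]
      Ck_has_derivative[OF assms(2) _ assms(3,4)]) simp_all

lemma partial_deriv_mult:
  assumes "Ck N V 1 f" "Ck N V 1 g" "i < N" "x \<in> V"
  shows "partial_deriv i (\<lambda>x. f x * g x) x = partial_deriv i f x * g x + f x * partial_deriv i g x"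
proof (rule partial_deriv_eqI)
  show "((\<lambda>s. f (x(i := s)) * g (x(i := s))) has_real_derivative
      partial_deriv i f x * g x + f x * partial_deriv i g x) (at (x i))"
    using DERIV_mult[OF Ck_has_derivative[OF assms(1) _ assms(3,4)] Ck_has_derivative[OF assms(2) _ assms(3,4)]]
    by (simp only: fun_upd_triv zero_less_one mult.commute[of "f x"])
qed

lemma partial_deriv_sum:
  assumes "open V" "finite A" "\<And>a. a \<in> A \<Longrightarrow> Ck N V 1 (f a)" "i < N" "x \<in> V"
  shows "partial_deriv i (\<lambda>x. \<Sum>a\<in>A. f a x) x = (\<Sum>a\<in>A. partial_deriv i (f a) x)"
  using assms(2,3)
proof (induction A rule: finite_induct)
  case (insert a A)
  have "Ck N V 1 (\<lambda>x. \<Sum>a\<in>A. f a x)"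
    by (rule Ck_sum[OF assms(1)]) (use insert in auto)
  then show ?case
    using insert assms(4,5) by (simp add: partial_deriv_add[of N V])
qed (simp add: partial_deriv_const)

lemma Ck_sum_list:
  assumes "open V" "\<And>a. a \<in> set as \<Longrightarrow> Ck N V k (f a)"
  shows "Ck N V k (\<lambda>x. \<Sum>a\<leftarrow>as. f a x)"
  using assms(2) by (induction as) (auto intro!: Ck_const Ck_add assms(1))

lemma partial_deriv_sum_list:
  assumes "open V" "\<And>a. a \<in> set as \<Longrightarrow> Ck N V 1 (f a)" "i < N" "x \<in> V"
  shows "partial_deriv i (\<lambda>x. \<Sum>a\<leftarrow>as. f a x) x = (\<Sum>a\<leftarrow>as. partial_deriv i (f a) x)"
  using assms(2)
proof (induction as)
  case (Cons a as)
  have "Ck N V 1 (\<lambda>x. \<Sum>a\<leftarrow>as. f a x)"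
    by (rule Ck_sum_list[OF assms(1)]) (use Cons in auto)
  then show ?case
    using Cons assms(3,4) by (simp add: partial_deriv_add[of N V])
qed (simp add: partial_deriv_const)

section \<open>The free associative algebra\<close>

text \<open>The value at \<open>\<xi>\<^bsub>[I]\<^esub>\<close> of the linear functional taking each word \<open>\<xi>\<^sub>K\<close> to \<open>\<phi> K\<close>.\<close>

fun bracket_sum :: "nat list \<Rightarrow> (nat list \<Rightarrow> real) \<Rightarrow> real" where
  "bracket_sum [] \<phi> = 0"
| "bracket_sum [i] \<phi> = \<phi> [i]"
| "bracket_sum (i # j # I) \<phi> =
     bracket_sum (j # I) (\<lambda>K. \<phi> (i # K)) - bracket_sum (j # I) (\<lambda>K. \<phi> (K @ [i]))"

lemma bracket_sum_Cons:
  "I \<noteq> [] \<Longrightarrow> bracket_sum (i # I) \<phi> =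
     bracket_sum I (\<lambda>K. \<phi> (i # K)) - bracket_sum I (\<lambda>K. \<phi> (K @ [i]))"
  by (cases I) auto

text \<open>Expanding an iterated commutator only permutes its letters, so the functional is
  evaluated at rearrangements of \<open>I\<close> alone.\<close>

lemma bracket_sum_cong:
  "(\<And>K. mset K = mset I \<Longrightarrow> \<phi> K = \<psi> K) \<Longrightarrow> bracket_sum I \<phi> = bracket_sum I \<psi>"
proof (induction I \<phi> arbitrary: \<psi> rule: bracket_sum.induct)
  case (3 i j I \<phi>)
  have "bracket_sum (j # I) (\<lambda>K. \<phi> (i # K)) = bracket_sum (j # I) (\<lambda>K. \<psi> (i # K))"
    by (rule 3) (use "3.prems" in auto)
  moreover have "bracket_sum (j # I) (\<lambda>K. \<phi> (K @ [i])) = bracket_sum (j # I) (\<lambda>K. \<psi> (K @ [i]))"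
    by (rule 3) (use "3.prems" in auto)
  ultimately show ?case by simp
qed auto

lemma bracket_sum_sum:
  "bracket_sum I (\<lambda>K. \<Sum>a\<in>A. f a * \<phi> a K) = (\<Sum>a\<in>A. f a * bracket_sum I (\<phi> a))"
  \<comment> \<open>The dummy member \<open>\<phi> undefined\<close> fills the functional's place in
    the induction rule, so that the whole family can be generalised.\<close>
  by (induction I "\<phi> undefined" arbitrary: \<phi> rule: bracket_sum.induct)
    (simp_all add: sum_subtractf right_diff_distrib)

lemma lookup_times:
  fixes a b :: nc_poly
  shows "Poly_Mapping.lookup (a * b) J =
    (\<Sum>(x, y). Poly_Mapping.lookup a x * Poly_Mapping.lookup b y when J = x @ y)"
  by (simp add: times_poly_mapping.rep_eq prod_fun_unfold_prod plus_list_def)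

text \<open>Among the factorisations of \<open>J\<close>, only the one with left factor
  \<open>[i]\<close> contributes, so the sum over pairs collapses to a single point.\<close>

lemma lookup_xi_times:
  "Poly_Mapping.lookup (xi i * b) J =
     (if J \<noteq> [] \<and> hd J = i then Poly_Mapping.lookup b (tl J) else 0)"
proof -
  have "(\<lambda>(x, y). Poly_Mapping.lookup (xi i) x * Poly_Mapping.lookup b y when J = x @ y) =
    (\<lambda>xy. (if J \<noteq> [] \<and> hd J = i then Poly_Mapping.lookup b (tl J) else 0) when xy = ([i], tl J))"
    by (cases J) (auto simp: fun_eq_iff xi_def lookup_single when_def)
  then show ?thesis by (simp add: lookup_times)
qed

lemma lookup_times_xi:
  "Poly_Mapping.lookup (b * xi i) J =
     (if J \<noteq> [] \<and> last J = i then Poly_Mapping.lookup b (butlast J) else 0)"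
proof -
  have "(\<lambda>(x, y). Poly_Mapping.lookup b x * Poly_Mapping.lookup (xi i) y when J = x @ y) =
    (\<lambda>xy. (if J \<noteq> [] \<and> last J = i then Poly_Mapping.lookup b (butlast J) else 0)
       when xy = (butlast J, [i]))"
    by (cases J rule: rev_cases) (auto simp: fun_eq_iff xi_def lookup_single when_def)
  then show ?thesis by (simp add: lookup_times)
qed

text \<open>Reading off a coefficient is the indicator functional of \<open>J\<close>; the two terms
  of the recursion match multiplication by a letter on the left and on the right.\<close>

lemma A_coeff_eq_bracket_sum:
  "A_coeff I J = bracket_sum I (\<lambda>K. if K = J then 1 else 0)"
proof (induction I arbitrary: J rule: xi_bracket.induct)
  case (2 i)
  then show ?case by (simp add: A_coeff_def xi_def lookup_single when_def)
next
  case (3 i j I)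
  have zero: "bracket_sum I (\<lambda>K. 0) = 0" for I
    using bracket_sum_sum[of I _ _ "{}"] by simp
  have "bracket_sum (j # I) (\<lambda>K. if i # K = J then 1 else 0)
      = (if J \<noteq> [] \<and> hd J = i then bracket_sum (j # I) (\<lambda>K. if K = tl J then 1 else 0) else 0)"
    by (cases J) (auto simp: zero intro!: bracket_sum_cong)
  moreover have "bracket_sum (j # I) (\<lambda>K. if K @ [i] = J then 1 else 0)
      = (if J \<noteq> [] \<and> last J = i then bracket_sum (j # I) (\<lambda>K. if K = butlast J then 1 else 0) else 0)"
    by (cases J rule: rev_cases) (auto simp: zero intro!: bracket_sum_cong)
  ultimately show ?case
    using 3 by (simp add: A_coeff_def commutator_def lookup_minus lookup_xi_times lookup_times_xi)
qed (simp add: A_coeff_def)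

lemma A_coeff_eq_0: "mset I \<noteq> mset J \<Longrightarrow> A_coeff I J = 0"
proof -
  assume "mset I \<noteq> mset J"
  then have "A_coeff I J = bracket_sum I (\<lambda>K. \<Sum>a\<in>({}::nat set). 0 * 0)"
    unfolding A_coeff_eq_bracket_sum by (intro bracket_sum_cong) auto
  then show ?thesis by (subst (asm) bracket_sum_sum) simp
qed

text \<open>On the rearrangements of \<open>I\<close>, all in \<open>S\<close>, the functional is a
  combination of indicators, and linearity applies.\<close>

lemma bracket_sum_eq_sum_A_coeff:
  assumes "finite S" "\<And>K. mset K = mset I \<Longrightarrow> K \<in> S"
  shows "bracket_sum I \<phi> = (\<Sum>J\<in>S. A_coeff I J * \<phi> J)"
proof -
  have "bracket_sum I \<phi> = bracket_sum I (\<lambda>K. \<Sum>J\<in>S. \<phi> J * (if K = J then 1 else 0))"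
    using assms by (intro bracket_sum_cong) (simp add: if_distrib cong: if_cong)
  then show ?thesis
    by (simp add: bracket_sum_sum A_coeff_eq_bracket_sum mult.commute)
qed

text \<open>All ways of splitting a word into two complementary subwords: the coproduct of
  the free associative algebra for which the indeterminates are primitive.\<close>

fun splits :: "'a list \<Rightarrow> ('a list \<times> 'a list) list" where
  "splits [] = [([], [])]"
| "splits (x # xs) = map (\<lambda>(A, B). (x # A, B)) (splits xs) @ map (\<lambda>(A, B). (A, x # B)) (splits xs)"

lemma splits_mset: "(A, B) \<in> set (splits K) \<Longrightarrow> mset A + mset B = mset K"
  by (induction K arbitrary: A B) auto

lemma sum_list_uminus: "(\<Sum>x\<leftarrow>xs. - f x) = - (\<Sum>x\<leftarrow>xs. f x :: real)"
  by (induction xs) auto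

text \<open>This is the antipode axiom, the antipode being reversal with sign
  \<open>(-1) ^ length\<close>: the identity convolved with it is the counit. In the induction, the
  splittings with \<open>j\<close> on the left cancel those with \<open>j\<close> on the right
  unless \<open>J\<close> is empty, where both sums equal the value at \<open>[j]\<close> up to
  sign.\<close>

lemma splits_antipode:
  "(\<Sum>(A, B)\<leftarrow>splits J. (-1) ^ length B * (\<psi> (A @ rev B) :: real)) = (if J = [] then \<psi> [] else 0)"
proof (induction J arbitrary: \<psi>)
  case (Cons j J)
  show ?case
    using Cons.IH[of "\<lambda>K. \<psi> (j # K)"] Cons.IH[of "\<lambda>K. \<psi> (K @ [j])"]
    by (simp add: comp_def case_prod_unfold sum_list_uminus)
qed simp

text \<open>The Dynkin operator is the convolution of the length derivation with the antipode.\<close>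

lemma bracket_sum_Dynkin:
  "bracket_sum J \<phi> = (\<Sum>(A, B)\<leftarrow>splits J. real (length A) * ((-1) ^ length B * \<phi> (A @ rev B)))"
proof (induction J arbitrary: \<phi>)
  case (Cons j J)
  \<comment> \<open>Putting \<open>j\<close> into the left part raises its length by one. The extra
    middle sum is an antipode sum: it vanishes for nonempty \<open>J\<close> and supplies the value
    at \<open>[j]\<close> otherwise.\<close>
  have "(\<Sum>(A, B)\<leftarrow>splits (j # J). real (length A) * ((-1) ^ length B * \<phi> (A @ rev B)))
      = (\<Sum>(A, B)\<leftarrow>splits J. real (length A) * ((-1) ^ length B * \<phi> (j # A @ rev B)))
        + (\<Sum>(A, B)\<leftarrow>splits J. (-1) ^ length B * \<phi> (j # A @ rev B))
        - (\<Sum>(A, B)\<leftarrow>splits J. real (length A) * ((-1) ^ length B * \<phi> (A @ rev B @ [j])))"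
    by (simp add: comp_def case_prod_unfold algebra_simps sum_list_addf sum_list_uminus)
  also have "\<dots> = bracket_sum (j # J) \<phi>"
    using splits_antipode[of "\<lambda>K. \<phi> (j # K)" J] Cons.IH[of "\<lambda>K. \<phi> (j # K)"]
      Cons.IH[of "\<lambda>K. \<phi> (K @ [j])"]
    by (cases "J = []") (simp_all add: bracket_sum_Cons)
  finally show ?case by simp
qed simp

section \<open>Vector fields as differential operators\<close>

lemma Ck_bracket_sum:
  assumes "open V" "\<And>K. mset K = mset I \<Longrightarrow> Ck N V k (F K)"
  shows "Ck N V k (\<lambda>x. bracket_sum I (\<lambda>K. F K x))"
  using assms(2)
proof (induction I "\<lambda>K. F K undefined" arbitrary: F rule: bracket_sum.induct)
  case (3 i j I)
  show ?case
    using "3.hyps"(1)[of "\<lambda>K. F (i # K)"] "3.hyps"(2)[of "\<lambda>K. F (K @ [i])"] "3.prems"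
    by (simp add: Ck_diff[OF assms(1)])
qed (auto intro: Ck_const assms(1))

lemma partial_deriv_bracket_sum:
  assumes "open V" "\<And>K. mset K = mset I \<Longrightarrow> Ck N V 1 (F K)" "i < N" "x \<in> V"
  shows "partial_deriv i (\<lambda>x. bracket_sum I (\<lambda>K. F K x)) x = bracket_sum I (\<lambda>K. partial_deriv i (F K) x)"
  using assms(2)
proof (induction I "\<lambda>K. F K undefined" arbitrary: F rule: bracket_sum.induct)
  case (3 k j I)
  have "Ck N V 1 (\<lambda>x. bracket_sum (j # I) (\<lambda>K. F (k # K) x))"
    by (rule Ck_bracket_sum[OF assms(1)]) (use "3.prems" in auto)
  moreover have "Ck N V 1 (\<lambda>x. bracket_sum (j # I) (\<lambda>K. F (K @ [k]) x))"
    by (rule Ck_bracket_sum[OF assms(1)]) (use "3.prems" in auto)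
  ultimately show ?case
    using "3.hyps"(1)[of "\<lambda>K. F (k # K)"] "3.hyps"(2)[of "\<lambda>K. F (K @ [k])"] "3.prems"
    by (simp add: partial_deriv_diff[OF _ _ assms(3,4)])
qed (auto simp: partial_deriv_const)

section \<open>Weights, and the operators attached to words\<close>

definition index_weight :: "nat \<Rightarrow> nat" where
  "index_weight k = (if k = 0 then 2 else 1)"

lemma index_weight_ge_1: "1 \<le> index_weight k"
  by (simp add: index_weight_def)

lemma weight_simps [simp]:
  "weight [] = 0" "weight (k # K) = index_weight k + weight K" "weight (K @ L) = weight K + weight L"
  by (auto simp: weight_def index_weight_def)

lemma weight_pos: "K \<noteq> [] \<Longrightarrow> 0 < weight K"
  by (auto simp: weight_def neq_Nil_conv)

lemma sum_mult_sum_list: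
  fixes c :: "'a \<Rightarrow> real"
  shows "(\<Sum>j\<in>A. c j * (\<Sum>y\<leftarrow>ys. F j y)) = (\<Sum>y\<leftarrow>ys. \<Sum>j\<in>A. c j * F j y)"
  by (induction ys) (simp_all add: distrib_left sum.distrib)

lemma weight_mset: "mset K = mset L \<Longrightarrow> weight K = weight L"
  unfolding weight_def by (metis mset_map sum_mset_sum_list)

text \<open>The operator by which a word acts when each letter \<open>k\<close> acts as the field
  \<open>X k\<close>; the last letter acts first.\<close>

primrec word_op :: "nat \<Rightarrow> (nat \<Rightarrow> vfield) \<Rightarrow> nat list \<Rightarrow> (point \<Rightarrow> real) \<Rightarrow> point \<Rightarrow> real" where
  "word_op N X [] f = f"
| "word_op N X (k # K) f = (\<lambda>x. \<Sum>j<N. X k j x * partial_deriv j (word_op N X K f) x)"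

lemma word_op_append: "word_op N X (K @ L) f = word_op N X K (word_op N X L f)"
  by (induction K) auto

lemma iter_bracket_Cons:
  "I \<noteq> [] \<Longrightarrow> iter_bracket N X (i # I) = lie_bracket N (X i) (iter_bracket N X I)"
  by (cases I) auto

text \<open>\<open>V\<close> is open in the space of all sequences rather than in dimension
  \<open>N\<close>, so \<open>N\<close> can grow while \<open>V\<close> stays fixed.\<close>

locale weighted_fields =
  fixes N n r :: nat and V :: "point set" and X :: "nat \<Rightarrow> vfield"
  assumes open_V: "open V"
    and coeff_Ck: "\<And>k i. k \<le> n \<Longrightarrow> i < N \<Longrightarrow> Ck N V (r - index_weight k) (X k i)"
begin

text \<open>A letter \<open>k\<close> costs \<open>index_weight k\<close> orders of smoothness: one
  derivative is taken, and the coefficients of \<open>X k\<close> are only of class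
  \<open>r - index_weight k\<close>.\<close>

lemma word_op_Ck:
  assumes "set K \<subseteq> {0..n}" "q \<le> r" "weight K \<le> q" "Ck N V q f"
  shows "Ck N V (q - weight K) (word_op N X K f)"
  using assms(1,3)
proof (induction K)
  case (Cons k K)
  have "Ck N V (q - weight (k # K)) (X k j)" if "j < N" for j
    using coeff_Ck[of k j] Cons.prems that assms(2) by (auto intro: Ck_mono)
  moreover have "Ck N V (q - weight (k # K)) (partial_deriv j (word_op N X K f))" if "j < N" for j
    using Cons that index_weight_ge_1[of k]
    by (intro Ck_partial_deriv[of _ _ "q - weight K"]) auto
  ultimately show ?case
    by (simp only: word_op.simps) (intro Ck_sum Ck_mult open_V, auto)
qed (use assms(4) in simp)

text \<open>Each field is a derivation, so each letter acts on one of the two factors; the Leibniz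
  rule reproduces the recursion of \<open>splits\<close>.\<close>

lemma word_op_mult:
  assumes "set K \<subseteq> {0..n}" "weight K \<le> r" "Ck N V r f" "Ck N V r g" "x \<in> V"
  shows "word_op N X K (\<lambda>x. f x * g x) x =
    (\<Sum>(A, B)\<leftarrow>splits K. word_op N X A f x * word_op N X B g x)"
  using assms(1,2,5)
proof (induction K arbitrary: x)
  case (Cons k K)
  let ?f = "\<lambda>A. word_op N X A f" and ?g = "\<lambda>A. word_op N X A g"
  \<comment> \<open>The letter \<open>k\<close> is still to be applied, so both parts of a splitting
    of \<open>K\<close> have weight below \<open>r\<close> and leave one derivative.\<close>
  have reg: "Ck N V 1 (?f A)" "Ck N V 1 (?g B)" if "(A, B) \<in> set (splits K)" for A B
  proof -
    have m: "mset A + mset B = mset K" using splits_mset[OF that] .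
    have "weight A + weight B = weight K"
      using weight_mset[of "A @ B" K] m by simp
    moreover have "set A \<union> set B = set K"
      using m by (metis set_mset_mset set_mset_union)
    ultimately have *: "set A \<subseteq> {0..n}" "set B \<subseteq> {0..n}" "1 \<le> r - weight A" "1 \<le> r - weight B"
      "weight A \<le> r" "weight B \<le> r"
      using Cons.prems index_weight_ge_1[of k] by auto
    show "Ck N V 1 (?f A)" by (rule Ck_mono[OF word_op_Ck *(3)]) (use * assms(3) in auto)
    show "Ck N V 1 (?g B)" by (rule Ck_mono[OF word_op_Ck *(4)]) (use * assms(4) in auto)
  qed
  have "partial_deriv j (word_op N X K (\<lambda>x. f x * g x)) x =
      (\<Sum>(A, B)\<leftarrow>splits K. partial_deriv j (?f A) x * ?g B x + ?f A x * partial_deriv j (?g B) x)"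
    if j: "j < N" for j
  proof -
    have "partial_deriv j (word_op N X K (\<lambda>x. f x * g x)) x
        = partial_deriv j (\<lambda>x. \<Sum>AB\<leftarrow>splits K. ?f (fst AB) x * ?g (snd AB) x) x"
      using Cons by (intro partial_deriv_cong[OF open_V]) (auto simp: case_prod_unfold)
    also have "\<dots> = (\<Sum>AB\<leftarrow>splits K. partial_deriv j (\<lambda>x. ?f (fst AB) x * ?g (snd AB) x) x)"
      using Cons j reg by (intro partial_deriv_sum_list[OF open_V] Ck_mult[OF open_V]) auto
    also have "\<dots> = (\<Sum>(A, B)\<leftarrow>splits K. partial_deriv j (?f A) x * ?g B x + ?f A x * partial_deriv j (?g B) x)"
      unfolding case_prod_unfold
      by (intro arg_cong[of _ _ sum_list] map_cong refl partial_deriv_mult[of N V])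
        (use reg j Cons in auto)
    finally show ?thesis .
  qed
  then have "word_op N X (k # K) (\<lambda>x. f x * g x) x = (\<Sum>j<N. X k j x *
      (\<Sum>(A, B)\<leftarrow>splits K. partial_deriv j (?f A) x * ?g B x + ?f A x * partial_deriv j (?g B) x))"
    by simp
  also have "\<dots> = (\<Sum>(A, B)\<leftarrow>splits K. \<Sum>j<N. X k j x *
      (partial_deriv j (?f A) x * ?g B x + ?f A x * partial_deriv j (?g B) x))"
    by (simp add: case_prod_unfold sum_mult_sum_list)
  also have "\<dots> = (\<Sum>(A, B)\<leftarrow>splits K. ?f (k # A) x * ?g B x + ?f A x * ?g (k # B) x)"
    by (intro arg_cong[of _ _ sum_list] map_cong refl)
      (auto simp: algebra_simps sum.distrib sum_distrib_left)
  also have "\<dots> = (\<Sum>(A, B)\<leftarrow>splits (k # K). ?f A x * ?g B x)"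
    by (simp add: comp_def case_prod_unfold sum_list_addf)
  finally show ?case .
qed simp

lemma iter_bracket_Ck:
  assumes "I \<noteq> []" "set I \<subseteq> {0..n}" "weight I \<le> r" "l < N"
  shows "Ck N V (r - weight I) (iter_bracket N X I l)"
  using assms
proof (induction I arbitrary: l)
  case (Cons i I)
  show ?case
  proof (cases "I = []")
    case True
    then show ?thesis using Cons.prems coeff_Ck[of i l] by simp
  next
    case False
    have w: "1 \<le> weight I" "1 \<le> index_weight i"
      using weight_pos[OF False] index_weight_ge_1[of i] by auto
    have Y: "Ck N V (r - weight I) (iter_bracket N X I j)" if "j < N" for j
      using Cons False that by auto
    have X: "Ck N V (r - index_weight i) (X i j)" if "j < N" for j
      using Cons.prems coeff_Ck[of i j] that by auto
    let ?q = "r - weight (i # I)"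
    have "Ck N V ?q (X i j)" "Ck N V ?q (iter_bracket N X I j)"
      "Ck N V ?q (partial_deriv j (iter_bracket N X I l))" "Ck N V ?q (partial_deriv j (X i l))"
      if "j < N" for j
      using X[OF that] Y[OF that] X[OF Cons.prems(4)] Y[OF Cons.prems(4)] Cons.prems(3) w that
      by (auto elim: Ck_mono Ck_partial_deriv)
    then show ?thesis
      unfolding iter_bracket_Cons[OF False] lie_bracket_def
      by (intro Ck_sum Ck_diff Ck_mult open_V) auto
  qed
qed simp

text \<open>The bracket of two fields acts as the commutator of their operators, because the second
  derivatives of \<open>f\<close> cancel by symmetry. The induction hypothesis is used both for the
  function \<open>X i\<close> applied to \<open>f\<close> and for \<open>f\<close> at all points of
  \<open>V\<close>, hence the generalisation over both.\<close>

lemma iter_bracket_acts: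
  assumes "I \<noteq> []" "set I \<subseteq> {0..n}" "weight I \<le> r" "Ck N V (weight I) f" "x \<in> V"
  shows "(\<Sum>j<N. iter_bracket N X I j x * partial_deriv j f x) = bracket_sum I (\<lambda>K. word_op N X K f x)"
  using assms
proof (induction I arbitrary: f x)
  case (Cons i I)
  show ?case
  proof (cases "I = []")
    case False
    let ?Y = "iter_bracket N X I" and ?f = "word_op N X [i] f"
    have w: "1 \<le> weight I" "1 \<le> index_weight i" "weight I + index_weight i \<le> r"
      and I: "set I \<subseteq> {0..n}" "i \<le> n"
      using weight_pos[OF False] index_weight_ge_1[of i] Cons.prems by auto
    have Y: "Ck N V 1 (?Y j)" if "j < N" for j
      by (rule Ck_mono[OF iter_bracket_Ck]) (use Cons.prems False that w in auto)
    have X: "Ck N V (weight I) (X i j)" "Ck N V 1 (X i j)" if "j < N" for j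
      by (rule Ck_mono[OF coeff_Ck]; use I that w in simp)+
    have f2: "Ck N V 2 f"
      by (rule Ck_mono[OF Cons.prems(4)]) (use w in auto)
    have df: "Ck N V (weight I) (partial_deriv j f)" "Ck N V 1 (partial_deriv j f)" if "j < N" for j
      by (rule Ck_partial_deriv[OF Cons.prems(4)]; use w that in simp)+
    have f_wt: "Ck N V (weight I) f"
      by (rule Ck_mono[OF Cons.prems(4)]) (use w in auto)
    have if_wt: "Ck N V (weight I) ?f"
      by (simp, intro Ck_sum Ck_mult open_V) (use X df in auto)

    have "bracket_sum I (\<lambda>K. word_op N X (K @ [i]) f x) = bracket_sum I (\<lambda>K. word_op N X K ?f x)"
      by (simp only: word_op_append)
    also have "\<dots> = (\<Sum>j<N. ?Y j x * partial_deriv j ?f x)"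
      using Cons.IH[OF False I(1) _ if_wt Cons.prems(5)] w by simp
    also have "\<dots> = (\<Sum>j<N. ?Y j x * (\<Sum>l<N. partial_deriv j (X i l) x * partial_deriv l f x
        + X i l x * partial_deriv j (partial_deriv l f) x))"
    proof (intro sum.cong refl arg_cong2[of _ _ _ _ "(*)"])
      fix j assume "j \<in> {..<N}"
      then have j: "j < N" by simp
      have "partial_deriv j ?f x = (\<Sum>l<N. partial_deriv j (\<lambda>x. X i l x * partial_deriv l f x) x)"
        by (simp, rule partial_deriv_sum[OF open_V])
          (use Ck_mult[OF open_V X(2) df(2)] j Cons.prems(5) in auto)
      also have "\<dots> = (\<Sum>l<N. partial_deriv j (X i l) x * partial_deriv l f x
        + X i l x * partial_deriv j (partial_deriv l f) x)"
        by (intro sum.cong refl partial_deriv_mult[of N V]) (use X df j Cons.prems(5) in auto)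
      finally show "partial_deriv j ?f x = \<dots>" .
    qed
    finally have right: "bracket_sum I (\<lambda>K. word_op N X (K @ [i]) f x) =
      (\<Sum>j<N. \<Sum>l<N. ?Y j x * (partial_deriv j (X i l) x * partial_deriv l f x)
        + ?Y j x * (X i l x * partial_deriv j (partial_deriv l f) x))"
      by (simp add: sum_distrib_left distrib_left)

    have reg: "Ck N V 1 (word_op N X K f)" if "mset K = mset I" for K
    proof -
      have "weight K = weight I" "set K = set I"
        using weight_mset[OF that] mset_eq_setD[OF that] by auto
      then show ?thesis
        by (intro Ck_mono[OF word_op_Ck[of K "weight (i # I)"]]) (use Cons.prems w I in simp_all)
    qed
    have "bracket_sum I (\<lambda>K. word_op N X (i # K) f x)
        = (\<Sum>j<N. X i j x * bracket_sum I (\<lambda>K. partial_deriv j (word_op N X K f) x))"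
      by (simp add: bracket_sum_sum)
    also have "\<dots> = (\<Sum>j<N. X i j x * (\<Sum>l<N. partial_deriv j (?Y l) x * partial_deriv l f x
        + ?Y l x * partial_deriv j (partial_deriv l f) x))"
    proof (intro sum.cong refl arg_cong2[of _ _ _ _ "(*)"])
      fix j assume "j \<in> {..<N}"
      then have j: "j < N" by simp
      have "bracket_sum I (\<lambda>K. partial_deriv j (word_op N X K f) x)
          = partial_deriv j (\<lambda>x. bracket_sum I (\<lambda>K. word_op N X K f x)) x"
        by (rule partial_deriv_bracket_sum[OF open_V reg j Cons.prems(5), symmetric])
      also have "\<dots> = partial_deriv j (\<lambda>x. \<Sum>l<N. ?Y l x * partial_deriv l f x) x"
        by (rule partial_deriv_cong[OF open_V Cons.prems(5)])
          (use Cons.IH[OF False I(1) _ f_wt] w in simp)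
      also have "\<dots> = (\<Sum>l<N. partial_deriv j (\<lambda>x. ?Y l x * partial_deriv l f x) x)"
        by (rule partial_deriv_sum[OF open_V])
          (use Ck_mult[OF open_V Y df(2)] j Cons.prems(5) in auto)
      also have "\<dots> = (\<Sum>l<N. partial_deriv j (?Y l) x * partial_deriv l f x
        + ?Y l x * partial_deriv j (partial_deriv l f) x)"
        by (intro sum.cong refl partial_deriv_mult[of N V]) (use Y df j Cons.prems(5) in auto)
      finally show "bracket_sum I (\<lambda>K. partial_deriv j (word_op N X K f) x) = \<dots>" .
    qed
    finally have left: "bracket_sum I (\<lambda>K. word_op N X (i # K) f x) =
      (\<Sum>j<N. \<Sum>l<N. X i j x * (partial_deriv j (?Y l) x * partial_deriv l f x)
        + X i j x * (?Y l x * partial_deriv j (partial_deriv l f) x))"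
      by (simp add: sum_distrib_left distrib_left)

    \<comment> \<open>The second order terms of \<open>left\<close> and \<open>right\<close> agree
      once the summation indices are exchanged.\<close>
    have "(\<Sum>j<N. \<Sum>l<N. X i j x * (?Y l x * partial_deriv j (partial_deriv l f) x))
        = (\<Sum>l<N. \<Sum>j<N. X i j x * (?Y l x * partial_deriv j (partial_deriv l f) x))"
      by (rule sum.swap)
    also have "\<dots> = (\<Sum>l<N. \<Sum>j<N. ?Y l x * (X i j x * partial_deriv l (partial_deriv j f) x))"
      by (intro sum.cong refl)
        (use partial_deriv_commute[OF open_V Cons.prems(5) f2] in \<open>simp add: mult.left_commute\<close>)
    finally have second: "(\<Sum>j<N. \<Sum>l<N. X i j x * (?Y l x * partial_deriv j (partial_deriv l f) x)) = \<dots>" .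

    have "(\<Sum>l<N. iter_bracket N X (i # I) l x * partial_deriv l f x)
        = (\<Sum>l<N. \<Sum>j<N. X i j x * (partial_deriv j (?Y l) x * partial_deriv l f x)
            - ?Y j x * (partial_deriv j (X i l) x * partial_deriv l f x))"
      unfolding iter_bracket_Cons[OF False] lie_bracket_def
      by (simp add: sum_distrib_right left_diff_distrib mult.assoc)
    also have "\<dots> = (\<Sum>j<N. \<Sum>l<N. X i j x * (partial_deriv j (?Y l) x * partial_deriv l f x)
            - ?Y j x * (partial_deriv j (X i l) x * partial_deriv l f x))"
      by (rule sum.swap)
    also have "\<dots> = bracket_sum (i # I) (\<lambda>K. word_op N X K f x)"
      unfolding bracket_sum_Cons[OF False] left right
      by (simp only: sum.distrib sum_subtractf second)
    finally show ?thesis .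
  qed simp
qed simp

text \<open>A field applied to a coordinate function returns the corresponding coefficient.\<close>

lemma iter_bracket_eq:
  assumes "multiindex n I" "weight I \<le> r" "i < N" "x \<in> V"
  shows "iter_bracket N X I i x = bracket_sum I (\<lambda>K. word_op N X K (\<lambda>x. x i) x)"
  using iter_bracket_acts[of I "\<lambda>x. x i" x] assms
  by (simp add: multiindex_def Ck_coordinate open_V partial_deriv_coordinate if_distrib cong: if_cong)

end

section \<open>Separation of words by monomials\<close>

definition monomial :: "nat \<Rightarrow> (nat \<Rightarrow> nat) \<Rightarrow> point \<Rightarrow> real" where
  "monomial N \<alpha> z = (\<Prod>i<N. z i ^ \<alpha> i)"

lemma monomial_0: "monomial N (\<lambda>_. 0) = (\<lambda>_. 1)"
  by (simp add: monomial_def fun_eq_iff)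

lemma monomial_coordinate: "i < N \<Longrightarrow> monomial N (\<lambda>j. if j = i then 1 else 0) = (\<lambda>z. z i)"
  by (simp add: monomial_def fun_eq_iff if_distrib prod.delta cong: if_cong)

lemma monomial_add: "monomial N (\<lambda>i. \<alpha> i + \<beta> i) = (\<lambda>z. monomial N \<alpha> z * monomial N \<beta> z)"
  by (simp add: monomial_def fun_eq_iff power_add prod.distrib)

lemma Ck_monomial:
  assumes "open V"
  shows "Ck M V k (monomial N \<alpha>)"
proof -
  have pow: "Ck M V k (\<lambda>z. z i ^ a)" for i a
    by (induction a) (auto intro!: Ck_const Ck_mult Ck_coordinate assms)
  have "Ck M V k (\<lambda>z. \<Prod>i<N. z i ^ \<alpha> i)"
    by (induction N) (auto intro!: Ck_const Ck_mult pow assms)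
  then show ?thesis by (simp add: monomial_def[abs_def])
qed

lemma monomial_polynomial_in_first: "polynomial_in_first N (monomial N \<alpha>)"
  unfolding polynomial_in_first_def monomial_def
  by (intro exI[of _ "{\<alpha>}"] exI[of _ "\<lambda>_. 1"]) simp

lemma zero_polynomial_in_first: "polynomial_in_first N (\<lambda>_. 0)"
  unfolding polynomial_in_first_def by (intro exI[of _ "{}"]) simp

definition words :: "nat \<Rightarrow> nat \<Rightarrow> nat \<Rightarrow> nat list set" where
  "words n s l = {K. set K \<subseteq> {0..n} \<and> weight K \<le> s \<and> length K \<le> l}"

lemma length_le_weight: "length K \<le> weight K"
  by (induction K) (auto simp: index_weight_def)

lemma finite_words: "finite (words n s l)"
  by (rule finite_subset[OF _ finite_lists_length_le[of "{0..n}" l]]) (auto simp: words_def)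

lemma multiindices_upto_words: "multiindices_upto n s = words n s s - {[]}"
  using length_le_weight le_trans unfolding multiindices_upto_def multiindex_def words_def by blast

lemma splits_words:
  assumes "(A, B) \<in> set (splits K)" "K \<in> words n s l"
  shows "A \<in> words n s l" "B \<in> words n s l"
proof -
  have m: "mset A + mset B = mset K" using splits_mset[OF assms(1)] .
  have "weight A + weight B = weight K"
    using weight_mset[of "A @ B" K] m by simp
  moreover have "set A \<union> set B = set K" "length A + length B = length K"
    using m by (metis set_mset_mset set_mset_union, metis size_mset size_union)
  ultimately show "A \<in> words n s l" "B \<in> words n s l"
    using assms(2) by (auto simp: words_def)
qed

lemma splits_length: "(A, B) \<in> set (splits K) \<Longrightarrow> length A + length B = length K"
  by (metis splits_mset size_mset size_union)

lemma sum_list_eq_sum_count: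
  fixes h :: "'a \<Rightarrow> real"
  assumes "finite S" "set ys \<subseteq> S"
  shows "(\<Sum>y\<leftarrow>ys. h y) = (\<Sum>y\<in>S. real (count_list ys y) * h y)"
  using assms(2)
proof (induction ys)
  case (Cons y ys)
  have "(\<Sum>x\<in>S. real (count_list (y # ys) x) * h x)
      = (\<Sum>x\<in>S. (if x = y then h x else 0) + real (count_list ys x) * h x)"
    by (intro sum.cong) (auto simp: algebra_simps)
  then show ?case
    using Cons assms(1) by (simp add: sum.distrib)
qed simp

lemma count_splits_Nil_left:
  fixes K B :: "'a list"
  shows "count_list (splits K) ([], B) = (if K = B then 1 else 0)"
proof (induction K arbitrary: B)
  case (Cons k K)
  have "count_list (map (\<lambda>(A, B). (A, k # B)) ys) ([], B) =
      (case B of [] \<Rightarrow> 0 | b # B' \<Rightarrow> if b = k then count_list ys ([], B') else 0)" for ys :: "('a list \<times> 'a list) list"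
    by (induction ys) (auto split: list.splits)
  moreover have "count_list (map (\<lambda>(A, B). (k # A, B)) ys) ([], B) = 0" for ys :: "('a list \<times> 'a list) list"
    by (induction ys) auto
  ultimately show ?case using Cons by (auto split: list.splits)
qed auto

lemma count_splits_Nil_right:
  fixes K A :: "'a list"
  shows "count_list (splits K) (A, []) = (if K = A then 1 else 0)"
proof (induction K arbitrary: A)
  case (Cons k K)
  have "count_list (map (\<lambda>(A, B). (k # A, B)) ys) (A, []) =
      (case A of [] \<Rightarrow> 0 | b # A' \<Rightarrow> if b = k then count_list ys (A', []) else 0)" for ys :: "('a list \<times> 'a list) list"
    by (induction ys) (auto split: list.splits)
  moreover have "count_list (map (\<lambda>(A, B). (A, k # B)) ys) (A, []) = 0" for ys :: "('a list \<times> 'a list) list"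
    by (induction ys) auto
  ultimately show ?case using Cons by (auto split: list.splits)
qed auto

text \<open>The coefficient of the tensor of \<open>A\<close> and \<open>B\<close> in the coproduct
  of \<open>Q\<close>. Multiplicities are counted because a word with repeated letters can give the
  same pair several times.\<close>

definition coproduct :: "nat list set \<Rightarrow> (nat list \<Rightarrow> real) \<Rightarrow> nat list \<Rightarrow> nat list \<Rightarrow> real" where
  "coproduct W Q A B = (\<Sum>K\<in>W. Q K * real (count_list (splits K) (A, B)))"

text \<open>\<open>W\<close> contains both parts of every splitting of its words, so the sum can be
  regrouped by pairs.\<close>

lemma sum_splits_eq_coproduct:
  fixes n s l and h :: "nat list \<Rightarrow> nat list \<Rightarrow> real"
  defines "W \<equiv> words n s l"
  shows "(\<Sum>K\<in>W. Q K * (\<Sum>(A, B)\<leftarrow>splits K. h A B)) = (\<Sum>A\<in>W. \<Sum>B\<in>W. coproduct W Q A B * h A B)"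
proof -
  have fin: "finite W" by (simp add: W_def finite_words)
  have "(\<Sum>(A, B)\<leftarrow>splits K. h A B) = (\<Sum>(A, B)\<in>W \<times> W. real (count_list (splits K) (A, B)) * h A B)"
    if "K \<in> W" for K
    using splits_words that fin unfolding W_def case_prod_unfold
    by (subst sum_list_eq_sum_count) auto
  then have "(\<Sum>K\<in>W. Q K * (\<Sum>(A, B)\<leftarrow>splits K. h A B))
      = (\<Sum>K\<in>W. \<Sum>(A, B)\<in>W \<times> W. Q K * (real (count_list (splits K) (A, B)) * h A B))"
    by (simp add: sum_distrib_left case_prod_unfold)
  also have "\<dots> = (\<Sum>(A, B)\<in>W \<times> W. \<Sum>K\<in>W. Q K * (real (count_list (splits K) (A, B)) * h A B))"
    unfolding case_prod_unfold by (rule sum.swap)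
  also have "\<dots> = (\<Sum>(A, B)\<in>W \<times> W. coproduct W Q A B * h A B)"
    by (simp add: coproduct_def sum_distrib_right mult.assoc)
  finally show ?thesis by (simp add: sum.cartesian_product)
qed

text \<open>Friedrichs' criterion: a primitive element is a Lie element, by the Dynkin--Specht--Wever
  formula.\<close>

lemma primitive_is_Lie:
  fixes n s l and Q :: "nat list \<Rightarrow> real"
  defines "W \<equiv> words n s l"
  assumes prim: "\<And>A B. A \<in> W \<Longrightarrow> B \<in> W \<Longrightarrow> A \<noteq> [] \<Longrightarrow> B \<noteq> [] \<Longrightarrow> coproduct W Q A B = 0"
    and "Q [] = 0"
  shows "(\<Sum>J\<in>W. Q J / real (length J) * bracket_sum J \<phi>) = (\<Sum>K\<in>W. Q K * \<phi> K)"
proof -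
  have fin: "finite W" by (simp add: W_def finite_words)
  \<comment> \<open>All words in the expansion have the length of \<open>J\<close>, so the
    normalising division may be moved inside the functional.\<close>
  have "bracket_sum J (\<lambda>K. \<phi> K / real (length K)) = bracket_sum J \<phi> / real (length J)" for J
  proof -
    have "bracket_sum J (\<lambda>K. \<phi> K / real (length K))
        = bracket_sum J (\<lambda>K. \<Sum>a\<in>{0::nat}. (1 / real (length J)) * \<phi> K)"
      by (intro bracket_sum_cong) (auto simp: divide_inverse mult.commute dest: mset_eq_length)
    then show ?thesis by (subst (asm) bracket_sum_sum) simp
  qed
  then have "(\<Sum>J\<in>W. Q J / real (length J) * bracket_sum J \<phi>)
      = (\<Sum>J\<in>W. Q J * (\<Sum>(A, B)\<leftarrow>splits J.
          real (length A) * ((-1) ^ length B * (\<phi> (A @ rev B) / real (length (A @ rev B))))))"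
    by (simp only: bracket_sum_Dynkin[symmetric, where \<phi> = "\<lambda>K. \<phi> K / real (length K)"]) simp
  also have "\<dots> = (\<Sum>A\<in>W. \<Sum>B\<in>W. coproduct W Q A B *
      (real (length A) * ((-1) ^ length B * (\<phi> (A @ rev B) / real (length (A @ rev B))))))"
    unfolding W_def by (rule sum_splits_eq_coproduct)
  \<comment> \<open>Primitivity kills the pairs with two nonempty parts, and the factor
    \<open>length A\<close> those with \<open>A\<close> empty. For \<open>B\<close> empty the length
    cancels against the normalisation.\<close>
  also have "\<dots> = (\<Sum>A\<in>W. \<Sum>B\<in>W. if B = [] then Q A * \<phi> A else 0)"
  proof (intro sum.cong refl)
    fix A B assume AB: "A \<in> W" "B \<in> W"
    have "coproduct W Q A [] = Q A"
      using AB(1) fin by (simp add: coproduct_def count_splits_Nil_right if_distrib cong: if_cong)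
    then show "coproduct W Q A B *
      (real (length A) * ((-1) ^ length B * (\<phi> (A @ rev B) / real (length (A @ rev B)))))
      = (if B = [] then Q A * \<phi> A else 0)"
      using prim[OF AB] assms(3) by (cases "A = []") auto
  qed
  also have "\<dots> = (\<Sum>A\<in>W. Q A * \<phi> A)"
    using fin by (intro sum.cong refl) (auto simp: W_def words_def)
  finally show ?thesis .
qed

context weighted_fields
begin

text \<open>Induction on the length bound. Testing on products of monomials shows that the reduced
  coproduct of \<open>Q\<close> is annihilated in both tensor factors; these involve shorter words,
  so the induction hypothesis makes \<open>Q\<close> primitive, and freeness then excludes a nonzero
  \<open>Q\<close>.\<close>

lemma words_separated:
  assumes zero: "(\<lambda>_. 0) \<in> V" and free: "free_at N n s X (\<lambda>_. 0)" and "s \<le> r"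
    and "\<And>\<alpha>. (\<Sum>K\<in>words n s l. Q K * word_op N X K (monomial N \<alpha>) (\<lambda>_. 0)) = 0"
    and "K \<in> words n s l"
  shows "Q K = 0"
  using assms(4,5)
proof (induction l arbitrary: Q K)
  case 0
  have "words n s 0 = {[]}"
    by (auto simp: words_def)
  then show ?case
    using 0(1)[of "\<lambda>_. 0"] 0(2) by (simp add: monomial_0)
next
  case (Suc l)
  define W where "W = words n s (Suc l)"
  define e where "e = (\<lambda>A \<alpha>. word_op N X A (monomial N \<alpha>) (\<lambda>_. 0))"
  have fin: "finite W" by (simp add: W_def finite_words)
  have Nil: "[] \<in> W" by (simp add: W_def words_def)
  have ann: "(\<Sum>K\<in>W. Q K * e K \<alpha>) = 0" for \<alpha>
    using Suc.prems(1) by (simp add: W_def e_def)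
  have e_add: "e K (\<lambda>i. \<alpha> i + \<beta> i) = (\<Sum>(A, B)\<leftarrow>splits K. e A \<alpha> * e B \<beta>)" if "K \<in> W" for K \<alpha> \<beta>
    unfolding e_def monomial_add
    by (rule word_op_mult) (use that zero assms(3) in \<open>auto simp: W_def words_def intro: Ck_monomial open_V\<close>)
  have e_1: "e K (\<lambda>_. 0) = (if K = [] then 1 else 0)" for K
  proof -
    have "word_op N X K (\<lambda>_. 1) = (\<lambda>_. if K = [] then 1 else 0)"
      by (induction K) (auto simp: partial_deriv_const)
    then show ?thesis by (simp add: e_def monomial_0)
  qed
  have Q_Nil: "Q [] = 0"
    using ann[of "\<lambda>_. 0"] fin Nil by (simp add: e_1 if_distrib cong: if_cong)
  \<comment> \<open>The reduced coproduct: what remains after removing the terms in which one part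
    is empty, which by \<open>cop\<close> are two copies of \<open>Q\<close>.\<close>
  define R where "R A B = (if A = [] \<or> B = [] then 0 else coproduct W Q A B)" for A B
  have cop: "coproduct W Q A B = R A B + (if A = [] then Q B else 0) + (if B = [] then Q A else 0)"
    if "A \<in> W" "B \<in> W" for A B
    using that fin Q_Nil unfolding R_def
    by (auto simp: coproduct_def count_splits_Nil_right count_splits_Nil_left if_distrib cong: if_cong)
  \<comment> \<open>When both parts are nonempty, neither can use all \<open>Suc l\<close>
    letters.\<close>
  have R_long: "R A B = 0" if "A \<notin> words n s l \<or> B \<notin> words n s l" "A \<in> W" "B \<in> W" for A B
  proof (rule ccontr)
    assume "R A B \<noteq> 0"
    then have ne: "A \<noteq> []" "B \<noteq> []" and "coproduct W Q A B \<noteq> 0"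
      by (auto simp: R_def split: if_splits)
    then obtain K where "K \<in> W" "Q K * real (count_list (splits K) (A, B)) \<noteq> 0"
      unfolding coproduct_def by (elim sum.not_neutral_contains_not_neutral)
    then have "K \<in> W" "(A, B) \<in> set (splits K)"
      by (auto simp: count_list_0_iff)
    then have "length A + length B \<le> Suc l"
      using splits_length by (fastforce simp: W_def words_def)
    then show False
      using that ne by (cases A; cases B) (auto simp: W_def words_def)
  qed
  \<comment> \<open>Expanding the vanishing sum for a product of monomials, the terms with an empty
    part contain a factor that is the sum for \<alpha> or \<beta> alone, hence vanish.\<close>
  have R_ann: "(\<Sum>A\<in>words n s l. (\<Sum>B\<in>words n s l. R A B * e B \<beta>) * e A \<alpha>) = 0" for \<alpha> \<beta>
  proof -
    have sub: "words n s l \<subseteq> W" by (auto simp: W_def words_def)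
    have "0 = (\<Sum>K\<in>W. Q K * e K (\<lambda>i. \<alpha> i + \<beta> i))"
      using ann by simp
    also have "\<dots> = (\<Sum>A\<in>W. \<Sum>B\<in>W. coproduct W Q A B * (e A \<alpha> * e B \<beta>))"
      unfolding W_def by (subst sum_splits_eq_coproduct[symmetric]) (simp add: e_add[unfolded W_def])
    also have "\<dots> = (\<Sum>A\<in>W. \<Sum>B\<in>W. R A B * (e A \<alpha> * e B \<beta>)
        + ((if A = [] then e A \<alpha> * (Q B * e B \<beta>) else 0) + (if B = [] then Q A * e A \<alpha> * e B \<beta> else 0)))"
      by (intro sum.cong refl) (auto simp: cop algebra_simps)
    also have "\<dots> = (\<Sum>A\<in>W. \<Sum>B\<in>W. R A B * (e A \<alpha> * e B \<beta>))
        + (\<Sum>A\<in>W. \<Sum>B\<in>W. if A = [] then e A \<alpha> * (Q B * e B \<beta>) else 0)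
        + (\<Sum>A\<in>W. \<Sum>B\<in>W. if B = [] then Q A * e A \<alpha> * e B \<beta> else 0)"
      by (simp add: sum.distrib)
    also have "(\<Sum>A\<in>W. \<Sum>B\<in>W. if A = [] then e A \<alpha> * (Q B * e B \<beta>) else 0) = 0"
    proof (rule sum.neutral, rule ballI)
      fix A
      show "(\<Sum>B\<in>W. if A = [] then e A \<alpha> * (Q B * e B \<beta>) else 0) = 0"
        using ann[of \<beta>] by (cases "A = []") (simp_all add: sum_distrib_left[symmetric])
    qed
    also have "(\<Sum>A\<in>W. \<Sum>B\<in>W. if B = [] then Q A * e A \<alpha> * e B \<beta> else 0) = (\<Sum>A\<in>W. Q A * e A \<alpha>) * e [] \<beta>"
      using fin Nil by (simp add: sum_distrib_right)
    also have "\<dots> = 0" by (simp add: ann)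
    finally have "0 = (\<Sum>A\<in>W. \<Sum>B\<in>W. R A B * (e A \<alpha> * e B \<beta>))" by simp
    also have "\<dots> = (\<Sum>A\<in>W. \<Sum>B\<in>words n s l. R A B * (e A \<alpha> * e B \<beta>))"
      by (intro sum.cong refl sum.mono_neutral_right fin sub) (use R_long in auto)
    also have "\<dots> = (\<Sum>A\<in>words n s l. \<Sum>B\<in>words n s l. R A B * (e A \<alpha> * e B \<beta>))"
      using sub R_long by (intro sum.mono_neutral_right fin sub) (auto intro!: sum.neutral)
    finally show ?thesis
      by (simp add: sum_distrib_left sum_distrib_right mult_ac)
  qed
  \<comment> \<open>The induction hypothesis is applied twice: first to the left part with \<beta>
    fixed, then to the right part with \<open>A\<close> fixed.\<close>
  have "(\<Sum>B\<in>words n s l. R A B * e B \<beta>) = 0" if "A \<in> words n s l" for A \<beta>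
    using Suc.IH[of "\<lambda>A. \<Sum>B\<in>words n s l. R A B * e B \<beta>"] R_ann that by (simp add: e_def)
  then have "R A B = 0" if "A \<in> words n s l" "B \<in> words n s l" for A B
    using Suc.IH[of "R A"] that by (simp add: e_def)
  then have R0: "R A B = 0" if "A \<in> W" "B \<in> W" for A B
    using R_long that by blast
  have Lie: "(\<Sum>J\<in>W. Q J / real (length J) * bracket_sum J \<phi>) = (\<Sum>K\<in>W. Q K * \<phi> K)" for \<phi>
  proof -
    have "coproduct W Q A B = 0" if "A \<in> W" "B \<in> W" "A \<noteq> []" "B \<noteq> []" for A B
      using R0[OF that(1,2)] that(3,4) by (simp add: R_def)
    then show ?thesis
      unfolding W_def using Q_Nil by (intro primitive_is_Lie) simp_all
  qed
  \<comment> \<open>By \<open>Lie\<close>, these constants express \<open>Q\<close> through the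
    iterated commutators; they are extended by zero to all multiindices of weight at most
    \<open>s\<close>.\<close>
  define a where "a J = (if J \<in> W then Q J / real (length J) else 0)" for J
  have sum_a: "(\<Sum>I\<in>multiindices_upto n s. a I * c I) = (\<Sum>J\<in>W. Q J / real (length J) * c J)"
    for c :: "nat list \<Rightarrow> real"
  proof -
    have "W \<subseteq> words n s s"
      unfolding W_def words_def using length_le_weight le_trans by blast
    then have "(\<Sum>I\<in>multiindices_upto n s. a I * c I) = (\<Sum>I\<in>W - {[]}. a I * c I)"
      unfolding multiindices_upto_words
      by (intro sum.mono_neutral_right) (auto simp: a_def finite_words)
    also have "\<dots> = (\<Sum>J\<in>W. Q J / real (length J) * c J)"
      using fin Q_Nil by (intro sum.mono_neutral_cong_left) (auto simp: a_def)
    finally show ?thesis .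
  qed
  have "(\<Sum>I\<in>multiindices_upto n s. a I * iter_bracket N X I i (\<lambda>_. 0)) = 0" if "i < N" for i
  proof -
    have "(\<Sum>I\<in>multiindices_upto n s. a I * iter_bracket N X I i (\<lambda>_. 0))
        = (\<Sum>I\<in>multiindices_upto n s. a I * bracket_sum I (\<lambda>K. word_op N X K (\<lambda>x. x i) (\<lambda>_. 0)))"
      using that zero assms(3)
      by (intro sum.cong refl) (auto simp: multiindices_upto_def iter_bracket_eq)
    also have "\<dots> = 0"
      unfolding sum_a Lie using ann[of "\<lambda>j. if j = i then 1 else 0"] that
      by (simp add: e_def monomial_coordinate)
    finally show ?thesis .
  qed
  then have "(\<Sum>I\<in>multiindices_upto n s. a I * A_coeff I J) = 0" if "multiindex n J" for J
    using free that unfolding free_at_def by blast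
  \<comment> \<open>\<open>Lie\<close> is used with the indicator of \<open>J\<close>, turning the
    conclusion of freeness into a statement on \<open>Q J\<close> itself.\<close>
  then have "(\<Sum>K\<in>W. Q K * (if K = J then 1 else 0)) = 0" if "multiindex n J" for J
    using that unfolding sum_a A_coeff_eq_bracket_sum Lie by blast
  moreover have "(\<Sum>K\<in>W. Q K * (if K = J then 1 else 0)) = Q J" if "J \<in> W" for J
    using that fin by (simp add: if_distrib cong: if_cong)
  ultimately have "Q J = 0" if "J \<in> W" "multiindex n J" for J
    using that by metis
  then have "Q J = 0" if "J \<in> W" "J \<noteq> []" for J
    using that by (auto simp: multiindex_def W_def words_def)
  then show ?case
    using Suc.prems(2) Q_Nil by (auto simp: W_def)
qed

end

section \<open>The lifting\<close>

lemma multiindices_upto_mset: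
  "mset K = mset I \<Longrightarrow> K \<in> multiindices_upto n s \<longleftrightarrow> I \<in> multiindices_upto n s"
  using weight_mset[of K I] mset_eq_setD[of K I] by (auto simp: multiindices_upto_def multiindex_def)

lemma multiindices_upto_mono: "s \<le> t \<Longrightarrow> multiindices_upto n s \<subseteq> multiindices_upto n t"
  by (auto simp: multiindices_upto_def)

text \<open>Gaussian elimination: a vector with a nonzero entry at \<open>k\<close> serves as pivot
  and is removed together with that coordinate.\<close>

lemma spanning_card_le:
  fixes M :: "'a \<Rightarrow> 'b \<Rightarrow> real"
  assumes "finite S" "finite R" "\<And>v :: 'b \<Rightarrow> real. \<exists>c. \<forall>i\<in>R. v i = (\<Sum>I\<in>S. c I * M I i)"
  shows "card R \<le> card S"
  using assms
proof (induction S arbitrary: R M rule: finite_induct)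
  case empty
  have "R = {}"
    using empty.prems(2)[of "\<lambda>_. 1"] by auto
  then show ?case by simp
next
  case (insert I S)
  show ?case
  proof (cases "\<exists>i\<in>R. M I i \<noteq> 0")
    case False
    have "card R \<le> card S"
      using insert.prems insert.hyps False by (intro insert.IH) auto
    then show ?thesis using insert.hyps by simp
  next
    case True
    then obtain k where k: "k \<in> R" "M I k \<noteq> 0" by blast
    define M' where "M' J i = M J i - M J k * M I i / M I k" for J i
    have "\<exists>c. \<forall>i\<in>R - {k}. v i = (\<Sum>J\<in>S. c J * M' J i)" for v
    proof -
      \<comment> \<open>Prescribing the value 0 at \<open>k\<close> determines the pivot's
        coefficient from the others.\<close>
      obtain c where c: "\<forall>i\<in>R. (v(k := 0)) i = (\<Sum>J\<in>insert I S. c J * M J i)"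
        using insert.prems(2) by blast
      have "c I * M I k = - (\<Sum>J\<in>S. c J * M J k)"
        using c k(1) insert.hyps by (auto dest!: bspec[of R _ k])
      then have cI: "c I = - (\<Sum>J\<in>S. c J * M J k) / M I k"
        using k(2) by (simp add: field_simps)
      have "v i = (\<Sum>J\<in>S. c J * M' J i)" if "i \<in> R - {k}" for i
      proof -
        have "v i = c I * M I i + (\<Sum>J\<in>S. c J * M J i)"
          using c that insert.hyps by (auto dest!: bspec[of R _ i])
        also have "\<dots> = (\<Sum>J\<in>S. c J * M' J i)"
          unfolding cI M'_def
          by (simp add: right_diff_distrib sum_subtractf sum_distrib_right sum_divide_distrib mult.assoc)
        finally show ?thesis .
      qed
      then show ?thesis by blast
    qed
    then have "card (R - {k}) \<le> card S"
      using insert.prems(1) by (intro insert.IH) auto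
    then show ?thesis
      using insert.hyps insert.prems(1) k(1) by (simp add: card_Diff_singleton)
  qed
qed

lemma spans_at_card:
  assumes "spans_at N n r X x"
  shows "N \<le> card (multiindices_upto n r)"
proof -
  have "card {..<N} \<le> card (multiindices_upto n r)"
    using assms unfolding spans_at_def
    by (intro spanning_card_le[where M = "\<lambda>I i. iter_bracket N X I i x"] finite_multiindices_upto)
      (simp_all add: Ball_def)
  then show ?thesis by simp
qed

section \<open>Fields whose coefficients do not depend on the new variable\<close>

definition indep_coord :: "nat \<Rightarrow> (point \<Rightarrow> real) \<Rightarrow> bool" where
  "indep_coord i f \<longleftrightarrow> (\<forall>z t. f (z(i := t)) = f z)"

lemma partial_deriv_indep_coord: "indep_coord i f \<Longrightarrow> partial_deriv i f = (\<lambda>_. 0)"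
  by (simp add: partial_deriv_def indep_coord_def fun_eq_iff)

lemma indep_coord_partial_deriv:
  assumes "indep_coord i f" "j \<noteq> i"
  shows "indep_coord i (partial_deriv j f)"
  using assms by (simp add: partial_deriv_def indep_coord_def fun_upd_twist[of i j])

text \<open>The added derivative in direction \<open>N\<close> kills functions independent of that
  coordinate, and the old fields preserve this independence.\<close>

lemma word_op_indep_coord:
  assumes X: "\<And>k j. k \<le> n \<Longrightarrow> j < N \<Longrightarrow> indep_coord N (X k j)"
    and X': "\<And>k j. k \<le> n \<Longrightarrow> j < N \<Longrightarrow> X' k j = X k j"
    and f: "indep_coord N f" and K: "set K \<subseteq> {0..n}"
  shows "word_op (Suc N) X' K f = word_op N X K f \<and> indep_coord N (word_op N X K f)"
  using K
proof (induction K)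
  case (Cons k K)
  then have IH: "word_op (Suc N) X' K f = word_op N X K f" "indep_coord N (word_op N X K f)"
    and k: "k \<le> n" by auto
  have "indep_coord N (\<lambda>x. \<Sum>j<N. X k j x * partial_deriv j (word_op N X K f) x)"
    using X[OF k] indep_coord_partial_deriv[OF IH(2)]
    unfolding indep_coord_def by (intro allI sum.cong refl) simp
  then show ?case
    using IH X'[OF k] by (simp add: partial_deriv_indep_coord)
qed (use f in simp)

lemma word_op_zero: "word_op N X K (\<lambda>_. 0) = (\<lambda>_. 0)"
  by (induction K) (simp_all add: partial_deriv_const)

text \<open>The combination with coefficients \<open>a\<close> is a nonzero multiple of the new
  basis vector; adding a multiple \<mu> of it corrects the last coordinate without disturbing the
  others.\<close>

lemma spans_at_Suc:
  assumes span: "spans_at N n r X x"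
    and eq: "\<And>I i. I \<in> multiindices_upto n r \<Longrightarrow> i < N \<Longrightarrow>
      iter_bracket (Suc N) X' I i x = iter_bracket N X I i x"
    and a: "\<And>i. i < N \<Longrightarrow> (\<Sum>I\<in>multiindices_upto n r. a I * iter_bracket N X I i x) = 0"
    and d: "(\<Sum>I\<in>multiindices_upto n r. a I * iter_bracket (Suc N) X' I N x) \<noteq> 0"
  shows "spans_at (Suc N) n r X' x"
  unfolding spans_at_def
proof
  fix v :: "nat \<Rightarrow> real"
  let ?S = "multiindices_upto n r" and ?Y = "\<lambda>I i. iter_bracket (Suc N) X' I i x"
  obtain c where c: "\<forall>i<N. v i = (\<Sum>I\<in>?S. c I * iter_bracket N X I i x)"
    using span unfolding spans_at_def by blast
  define \<mu> where "\<mu> = (v N - (\<Sum>I\<in>?S. c I * ?Y I N)) / (\<Sum>I\<in>?S. a I * ?Y I N)"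
  have split: "(\<Sum>I\<in>?S. (c I + \<mu> * a I) * ?Y I i) = (\<Sum>I\<in>?S. c I * ?Y I i) + \<mu> * (\<Sum>I\<in>?S. a I * ?Y I i)" for i
    by (simp add: sum_distrib_left algebra_simps sum.distrib)
  have "v i = (\<Sum>I\<in>?S. (c I + \<mu> * a I) * ?Y I i)" if "i < Suc N" for i
  proof (cases "i = N")
    case True
    then show ?thesis unfolding split using d by (simp add: \<mu>_def)
  next
    case False
    then have "i < N" using that by simp
    then show ?thesis unfolding split using c a eq by simp
  qed
  then show "\<exists>c. \<forall>i<Suc N. v i = (\<Sum>I\<in>?S. c I * ?Y I i)"
    by (intro exI[of _ "\<lambda>I. c I + \<mu> * a I"]) simp
qed

text \<open>One step of the process. Regularity is assumed for every number \<open>M\<close> of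
  differentiated coordinates since both \<open>N\<close> and \<open>Suc N\<close> occur.\<close>

lemma not_free_extension:
  assumes V: "open V" "(\<lambda>_. 0) \<in> V"
    and X: "\<And>k i M. k \<le> n \<Longrightarrow> i < N \<Longrightarrow> Ck M V (r - index_weight k) (X k i)"
    and X_indep: "\<And>k i. k \<le> n \<Longrightarrow> i < N \<Longrightarrow> indep_coord N (X k i)"
    and span: "spans_at N n r X (\<lambda>_. 0)" and not_free: "\<not> free_at N n r X (\<lambda>_. 0)"
  obtains w where "\<And>k. polynomial_in_first N (w k)"
    "spans_at (Suc N) n r (\<lambda>k. (X k)(N := w k)) (\<lambda>_. 0)"
proof -
  let ?o = "(\<lambda>_. 0) :: point"
  interpret X: weighted_fields N n r V X
    by unfold_locales (use V X in auto)
  define s where "s = (LEAST s. \<not> free_at N n s X ?o)"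
  have not_free_s: "\<not> free_at N n s X ?o"
    unfolding s_def by (rule LeastI[of _ r]) (rule not_free)
  have "s \<le> r"
    unfolding s_def by (rule Least_le) (rule not_free)
  \<comment> \<open>No multiindex has weight 0, so freeness is vacuous there and
    \<open>s - 1\<close> is a genuine predecessor.\<close>
  have "free_at N n 0 X ?o"
    using weight_pos by (force simp: free_at_def multiindices_upto_def multiindex_def intro!: sum.neutral)
  then have "s \<noteq> 0"
    using not_free_s by metis
  then have free: "free_at N n (s - 1) X ?o"
    using not_less_Least[of "s - 1" "\<lambda>s. \<not> free_at N n s X ?o"] unfolding s_def[symmetric] by auto
  obtain a J\<^sub>0 where a: "\<And>i. i < N \<Longrightarrow> (\<Sum>I\<in>multiindices_upto n s. a I * iter_bracket N X I i ?o) = 0"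
    and J\<^sub>0: "multiindex n J\<^sub>0" "(\<Sum>I\<in>multiindices_upto n s. a I * A_coeff I J\<^sub>0) \<noteq> 0"
    using not_free_s unfolding free_at_def by blast
  define P where "P J = (\<Sum>I\<in>multiindices_upto n s. a I * A_coeff I J)" for J
  have P0: "P J = 0" if "J \<notin> multiindices_upto n s" for J
    unfolding P_def using that A_coeff_eq_0 multiindices_upto_mset
    by (intro sum.neutral) (metis mult_zero_right)
  obtain K\<^sub>0 k\<^sub>0 where K\<^sub>0: "J\<^sub>0 = K\<^sub>0 @ [k\<^sub>0]"
    using J\<^sub>0(1) by (cases J\<^sub>0 rule: rev_cases) (auto simp: multiindex_def)
  have P_J\<^sub>0: "P (K\<^sub>0 @ [k\<^sub>0]) \<noteq> 0"
    using J\<^sub>0(2) by (simp add: P_def K\<^sub>0)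
  define W where "W = words n (s - 1) (s - 1)"
  have in_W: "K \<in> W" if "K @ [k] \<in> multiindices_upto n s" for K k
    using that index_weight_ge_1[of k] length_le_weight[of K]
    by (auto simp: W_def words_def multiindices_upto_def multiindex_def)
  have "K\<^sub>0 \<in> W"
    using in_W P_J\<^sub>0 P0 by blast
  have "\<exists>\<alpha>. (\<Sum>K\<in>W. P (K @ [k\<^sub>0]) * word_op N X K (monomial N \<alpha>) ?o) \<noteq> 0"
  proof (rule ccontr)
    assume "\<not> ?thesis"
    then have "P (K\<^sub>0 @ [k\<^sub>0]) = 0"
      using X.words_separated[OF V(2) free, where l = "s - 1" and Q = "\<lambda>K. P (K @ [k\<^sub>0])" and K = K\<^sub>0]
        \<open>s \<le> r\<close> \<open>K\<^sub>0 \<in> W\<close> by (simp add: W_def)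
    then show False using P_J\<^sub>0 by simp
  qed
  then obtain \<alpha> where \<alpha>: "(\<Sum>K\<in>W. P (K @ [k\<^sub>0]) * word_op N X K (monomial N \<alpha>) ?o) \<noteq> 0"
    by blast
  \<comment> \<open>Only the field \<open>k\<^sub>0\<close> receives a component along the new
    variable, so only words ending in \<open>k\<^sub>0\<close> act nontrivially on it.\<close>
  define w where "w k = (if k = k\<^sub>0 then monomial N \<alpha> else (\<lambda>_. 0))" for k
  define X' where "X' = (\<lambda>k. (X k)(N := w k))"
  interpret X': weighted_fields "Suc N" n r V X'
    by unfold_locales (use V X in \<open>auto simp: X'_def w_def intro: Ck_monomial Ck_const\<close>)
  have w_indep: "indep_coord N (w k)" for k
    by (simp add: w_def indep_coord_def monomial_def)
  have word_op_X': "word_op (Suc N) X' K f = word_op N X K f"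
    if "indep_coord N f" "set K \<subseteq> {0..n}" for K f
    using word_op_indep_coord[of n N X X' f K] X_indep that by (simp add: X'_def)
  have bracket_X': "iter_bracket (Suc N) X' I i ?o = iter_bracket N X I i ?o"
    if "I \<in> multiindices_upto n r" "i < N" for I i
  proof -
    have "indep_coord N (\<lambda>x. x i)" using that by (simp add: indep_coord_def)
    then have "bracket_sum I (\<lambda>K. word_op (Suc N) X' K (\<lambda>x. x i) ?o)
        = bracket_sum I (\<lambda>K. word_op N X K (\<lambda>x. x i) ?o)"
      using that(1) by (intro bracket_sum_cong)
        (auto simp: word_op_X' multiindices_upto_def multiindex_def dest!: mset_eq_setD)
    then show ?thesis
      using that V(2) by (simp add: X.iter_bracket_eq X'.iter_bracket_eq multiindices_upto_def)
  qed
  \<comment> \<open>The last letter turns the new coordinate into \<open>w k\<close>, which does not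
    depend on it; the remaining letters then act as before.\<close>
  have word_op_last: "word_op (Suc N) X' (K @ [k]) (\<lambda>x. x N) = word_op N X K (w k)"
    if "set K \<subseteq> {0..n}" for K k
  proof -
    have "word_op (Suc N) X' [k] (\<lambda>x. x N) = w k"
      by (simp add: partial_deriv_coordinate X'_def if_distrib cong: if_cong)
    then show ?thesis
      using word_op_X'[OF w_indep that] by (simp only: word_op_append)
  qed

  define g where "g J = P J * (if last J = k\<^sub>0 then word_op N X (butlast J) (monomial N \<alpha>) ?o else 0)" for J
  have "(\<Sum>I\<in>multiindices_upto n s. a I * iter_bracket (Suc N) X' I N ?o)
      = (\<Sum>I\<in>multiindices_upto n s. \<Sum>J\<in>multiindices_upto n s. a I * A_coeff I J * word_op (Suc N) X' J (\<lambda>x. x N) ?o)"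
  proof (intro sum.cong refl)
    fix I assume I: "I \<in> multiindices_upto n s"
    have "iter_bracket (Suc N) X' I N ?o = bracket_sum I (\<lambda>K. word_op (Suc N) X' K (\<lambda>x. x N) ?o)"
      using I V(2) \<open>s \<le> r\<close> by (intro X'.iter_bracket_eq) (auto simp: multiindices_upto_def)
    also have "\<dots> = (\<Sum>J\<in>multiindices_upto n s. A_coeff I J * word_op (Suc N) X' J (\<lambda>x. x N) ?o)"
      by (rule bracket_sum_eq_sum_A_coeff[OF finite_multiindices_upto])
        (use I multiindices_upto_mset in blast)
    finally show "a I * iter_bracket (Suc N) X' I N ?o
        = (\<Sum>J\<in>multiindices_upto n s. a I * A_coeff I J * word_op (Suc N) X' J (\<lambda>x. x N) ?o)"
      by (simp add: sum_distrib_left mult.assoc)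
  qed
  also have "\<dots> = (\<Sum>J\<in>multiindices_upto n s. P J * word_op (Suc N) X' J (\<lambda>x. x N) ?o)"
    unfolding P_def sum_distrib_right by (rule sum.swap)
  also have "\<dots> = (\<Sum>J\<in>multiindices_upto n s. g J)"
  proof (intro sum.cong refl)
    fix J assume J: "J \<in> multiindices_upto n s"
    then obtain K k where "J = K @ [k]" "set K \<subseteq> {0..n}"
      by (cases J rule: rev_cases) (auto simp: multiindices_upto_def multiindex_def)
    then show "P J * word_op (Suc N) X' J (\<lambda>x. x N) ?o = g J"
      by (simp add: word_op_last g_def w_def word_op_zero)
  qed
  \<comment> \<open>The two index sets differ only by words not ending in \<open>k\<^sub>0\<close>,
    where \<open>g\<close> is 0, and by words that are not multiindices of weight at most
    \<open>s\<close>, where \<open>P\<close> is 0.\<close>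
  also have "\<dots> = (\<Sum>J\<in>(\<lambda>K. K @ [k\<^sub>0]) ` W. g J)"
  proof (rule sum.mono_neutral_cong)
    show "finite ((\<lambda>K. K @ [k\<^sub>0]) ` W)"
      by (simp add: W_def finite_words)
    show "g J = 0" if "J \<in> multiindices_upto n s - (\<lambda>K. K @ [k\<^sub>0]) ` W" for J
    proof (cases J rule: rev_cases)
      case (snoc K k)
      then show ?thesis using that in_W[of K k] by (auto simp: g_def)
    qed (use that in \<open>simp add: multiindices_upto_def multiindex_def\<close>)
  qed (auto simp: finite_multiindices_upto g_def P0)
  also have "\<dots> = (\<Sum>K\<in>W. P (K @ [k\<^sub>0]) * word_op N X K (monomial N \<alpha>) ?o)"
    by (subst sum.reindex) (auto simp: inj_on_def g_def)
  finally have last: "(\<Sum>I\<in>multiindices_upto n s. a I * iter_bracket (Suc N) X' I N ?o) \<noteq> 0"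
    using \<alpha> by simp

  define a' where "a' I = (if I \<in> multiindices_upto n s then a I else 0)" for I
  have extend: "(\<Sum>I\<in>multiindices_upto n r. a' I * c I) = (\<Sum>I\<in>multiindices_upto n s. a I * c I)" for c
    using multiindices_upto_mono[OF \<open>s \<le> r\<close>] finite_multiindices_upto
    by (intro sum.mono_neutral_cong_right) (auto simp: a'_def)
  have "spans_at (Suc N) n r X' ?o"
    by (rule spans_at_Suc[OF span, where a = a']) (use bracket_X' a last in \<open>auto simp: extend\<close>)
  moreover have "polynomial_in_first N (w k)" for k
    by (simp add: w_def monomial_polynomial_in_first zero_polynomial_in_first)
  ultimately show ?thesis
    using that[of w] by (simp add: X'_def)
qed

lemma Ck_polynomial_in_first:
  assumes "open V" "polynomial_in_first q f"
  shows "Ck M V k f"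
proof -
  obtain E c where "finite E" "\<And>z. f z = (\<Sum>\<alpha>\<in>E. c \<alpha> * monomial q \<alpha> z)"
    using assms(2) by (auto simp: polynomial_in_first_def monomial_def)
  then have "f = (\<lambda>z. \<Sum>\<alpha>\<in>E. c \<alpha> * monomial q \<alpha> z)" by blast
  then show ?thesis
    by (auto intro!: Ck_sum Ck_mult Ck_const Ck_monomial assms(1))
qed

lemma indep_coord_polynomial_in_first: "polynomial_in_first q f \<Longrightarrow> q \<le> i \<Longrightarrow> indep_coord i f"
  by (force simp: polynomial_in_first_def indep_coord_def)

lemma continuous_on_x_part: "continuous_on V (x_part p)"
proof (rule continuous_on_coordinatewise_then_product)
  show "continuous_on V (\<lambda>z. x_part p z i)" for i
    by (cases "i < p") (simp_all add: x_part_def continuous_on_coordinate)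
qed

lemma x_part_upd: "x_part p (z(i := t)) = (if i < p then (x_part p z)(i := t) else x_part p z)"
  by (auto simp: x_part_def fun_eq_iff)

text \<open>The cylinder over \<Omega> with all further coordinates free; it serves as common domain
  for every number of added variables.\<close>

lemma open_x_part_vimage:
  assumes "openin (Euclidean_space p) \<Omega>"
  shows "open (x_part p -` \<Omega>)"
proof -
  obtain T where "open T" "\<Omega> = T \<inter> {x. \<forall>i\<ge>p. x i = 0}"
    using assms by (auto simp: Euclidean_space_def openin_subtopology euclidean_product_topology)
  then have "x_part p -` \<Omega> = x_part p -` T"
    by (auto simp: x_part_def)
  then show ?thesis
    using open_vimage[OF \<open>open T\<close> continuous_on_x_part] by simp
qed

text \<open>Pulling back to the cylinder adds only directions in which the derivative is 0, so
  \<open>M\<close> is arbitrary.\<close>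

lemma Ck_x_part:
  assumes "open (x_part p -` \<Omega>)" "Ck p \<Omega> k f"
  shows "Ck M (x_part p -` \<Omega>) k (\<lambda>z. f (x_part p z))"
  using assms(2)
proof (induction k arbitrary: f)
  case 0
  then show ?case
    by (auto intro: continuous_on_compose2[OF _ continuous_on_x_part])
next
  case (Suc k)
  show ?case
  proof (rule Ck_SucI[OF assms(1), where f' = "\<lambda>i z. if i < p then partial_deriv i f (x_part p z) else 0"])
    show "continuous_on (x_part p -` \<Omega>) (\<lambda>z. f (x_part p z))"
      using Ck_continuous[OF Suc.prems] by (auto intro: continuous_on_compose2[OF _ continuous_on_x_part])
    show "((\<lambda>s. f (x_part p (x(i := s)))) has_real_derivative
        (if i < p then partial_deriv i f (x_part p x) else 0)) (at (x i))"
      if "x \<in> x_part p -` \<Omega>" for i x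
    proof (cases "i < p")
      case True
      then have "x_part p x i = x i" by (simp add: x_part_def)
      then show ?thesis
        using Ck_has_derivative[OF Suc.prems zero_less_Suc True, of "x_part p x"] that True
        by (simp only: x_part_upd if_True vimage_eq)
    qed (simp add: x_part_upd)
    show "Ck M (x_part p -` \<Omega>) k (\<lambda>z. if i < p then partial_deriv i f (x_part p z) else 0)" for i
      using Suc by (cases "i < p") (simp_all add: Ck_const[OF assms(1)])
  qed
qed

theorem theorem5:
  fixes r p n :: nat and \<Omega> :: "(nat \<Rightarrow> real) set" and X :: "nat \<Rightarrow> vfield"
  assumes "r \<ge> 2"
    and "bounded_domain p \<Omega>"
    and "(\<lambda>_. 0) \<in> \<Omega>"
    and "\<forall>k\<in>{1..n}. \<forall>i<p. Ck p \<Omega> (r - 1) (X k i)"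
    and "\<forall>i<p. Ck p \<Omega> (r - 2) (X 0 i)"
    and "spans_at p n r X (\<lambda>_. 0)"
  shows "\<exists>(m::nat) (u :: nat \<Rightarrow> nat \<Rightarrow> (nat \<Rightarrow> real) \<Rightarrow> real).
           (\<forall>k\<le>n. \<forall>j<m. polynomial_in_first (p + j) (u k j)) \<and>
           free_at (p + m) n r (\<lambda>k. lift_field p (X k) (u k)) (\<lambda>_. 0) \<and>
           spans_at (p + m) n r (\<lambda>k. lift_field p (X k) (u k)) (\<lambda>_. 0)"
proof -
  define V where "V = x_part p -` \<Omega>"
  have V: "open V" "(\<lambda>_. 0) \<in> V"
    using assms(2,3) open_x_part_vimage by (auto simp: V_def bounded_domain_def x_part_def)
  have X: "Ck M V (r - index_weight k) (\<lambda>z. X k i (x_part p z))" if "k \<le> n" "i < p" for M k i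
    unfolding V_def
    by (rule Ck_x_part) (use V assms(4,5) that in \<open>auto simp: V_def index_weight_def\<close>)

  \<comment> \<open>In dimension \<open>p\<close> only components below \<open>p\<close> enter the
    brackets, and there the lifted fields are pullbacks of the original ones, whatever
    \<open>u\<close> is.\<close>
  have start: "spans_at p n r (\<lambda>k. lift_field p (X k) u) (\<lambda>_. 0)" for u
  proof -
    have "iter_bracket p (\<lambda>k. lift_field p (X k) u) I i z = iter_bracket p X I i (x_part p z)"
      if "i < p" for I i z
      using that
    proof (induction I arbitrary: i z)
      case (Cons k I)
      have pd: "partial_deriv j (\<lambda>z. f (x_part p z)) z = partial_deriv j f (x_part p z)" if "j < p" for j f z
        using that by (simp add: partial_deriv_def x_part_upd) (simp add: x_part_def)
      show ?case
      proof (cases "I = []")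
        case False
        have "iter_bracket p (\<lambda>k. lift_field p (X k) u) I i = (\<lambda>z. iter_bracket p X I i (x_part p z))"
          "lift_field p (X k) u i = (\<lambda>z. X k i (x_part p z))" if "i < p" for i
          using Cons.IH[OF that] that by (auto simp: lift_field_def)
        then show ?thesis
          using Cons.prems by (simp add: iter_bracket_Cons[OF False] lie_bracket_def pd)
      qed (use Cons.prems in \<open>simp add: lift_field_def\<close>)
    qed simp
    moreover have "x_part p (\<lambda>_. 0) = (\<lambda>_. 0)" by (simp add: x_part_def)
    ultimately show ?thesis
      using assms(6) by (simp add: spans_at_def)
  qed

  have "?thesis" if "\<forall>k\<le>n. \<forall>j<m. polynomial_in_first (p + j) (u k j)"
    "spans_at (p + m) n r (\<lambda>k. lift_field p (X k) (u k)) (\<lambda>_. 0)" for m u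
    using that
  proof (induction "card (multiindices_upto n r) - (p + m)" arbitrary: m u rule: less_induct)
    case less
    define Y where "Y = (\<lambda>k. lift_field p (X k) (u k))"
    show ?case
    proof (cases "free_at (p + m) n r Y (\<lambda>_. 0)")
      case True
      then show ?thesis using less.prems unfolding Y_def by blast
    next
      case False
      have poly: "polynomial_in_first (p + (i - p)) (u k (i - p))" if "k \<le> n" "i < p + m" "\<not> i < p" for k i
        using less.prems(1)[rule_format, of k "i - p"] that by simp
      have Y: "Ck M V (r - index_weight k) (Y k i)" if "k \<le> n" "i < p + m" for M k i
        using X[OF that(1)] Ck_polynomial_in_first[OF V(1) poly[OF that]]
        by (cases "i < p") (simp_all add: Y_def lift_field_def)
      have Y_indep: "indep_coord (p + m) (Y k i)" if "k \<le> n" "i < p + m" for k i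
      proof (cases "i < p")
        case True
        then show ?thesis by (simp add: Y_def lift_field_def indep_coord_def x_part_upd)
      next
        case False
        then show ?thesis
          using indep_coord_polynomial_in_first[OF poly[OF that False]] that
          by (simp add: Y_def lift_field_def)
      qed
      obtain w where w: "\<And>k. polynomial_in_first (p + m) (w k)"
        and span: "spans_at (Suc (p + m)) n r (\<lambda>k. (Y k)(p + m := w k)) (\<lambda>_. 0)"
        using not_free_extension[OF V Y Y_indep less.prems(2)[folded Y_def] False] by metis
      \<comment> \<open>Slot \<open>m\<close> of \<open>u'\<close> is coordinate
        \<open>p + m\<close> of the lifted field.\<close>
      define u' where "u' k = (u k)(m := w k)" for k
      have "(\<lambda>k. (Y k)(p + m := w k)) = (\<lambda>k. lift_field p (X k) (u' k))"
        by (auto simp: fun_eq_iff Y_def u'_def lift_field_def)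
      then have span': "spans_at (p + Suc m) n r (\<lambda>k. lift_field p (X k) (u' k)) (\<lambda>_. 0)"
        using span by simp
      have "\<forall>k\<le>n. \<forall>j<Suc m. polynomial_in_first (p + j) (u' k j)"
        using less.prems(1) w by (auto simp: u'_def less_Suc_eq)
      \<comment> \<open>The enlarged system still spans, so \<open>p + Suc m\<close> does not exceed
        the cardinality and the truncated difference really decreases.\<close>
      moreover have "card (multiindices_upto n r) - (p + Suc m) < card (multiindices_upto n r) - (p + m)"
        using spans_at_card[OF span'] by simp
      ultimately show ?thesis
        using less.hyps[OF _ _ span'] by blast
    qed
  qed
  from this[of 0 "\<lambda>_ _ _. 0"] start show ?thesis by simp
qed

end
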